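(* There is an absolute constant $C>0$ such that for every integer $N\ge 2$ and every $u\in\mathbb{Z}_N$, there exists a simple planar graph $G$ on at most $C\log_2 N$ vertices with $\tau(G)\equiv u \pmod N$.
   Context: For a graph $G$, $\tau(G)$ denotes the number of spanning trees of $G$. *)

theory Defs
  imports "HOL-Analysis.Analysis" "HOL-Number_Theory.Cong"
begin

text \<open>
  A finite simple graph is a finite nonempty vertex set \<open>V\<close> together with a set \<open>E\<close> of two-element
  subsets of \<open>V\<close>. The symmetric digraphs of the AFP entry Graph_Theory are not used: there a
  pair of opposite arcs is already a cycle, so counting its spanning trees does not give
  the number of spanning trees of an undirected graph.
\<close>

definition simple_graph :: "'a set \<Rightarrow> 'a set set \<Rightarrow> bool" where
  "simple_graph V E \<longleftrightarrow> finite V \<and> V \<noteq> {} \<and> (\<forall>e\<in>E. e \<subseteq> V \<and> card e = 2)"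

definition graph_connected :: "'a set \<Rightarrow> 'a set set \<Rightarrow> bool" where
  "graph_connected V E \<longleftrightarrow> (\<forall>x\<in>V. \<forall>y\<in>V. (x, y) \<in> {(a, b). {a, b} \<in> E}\<^sup>*)"

definition graph_cycle :: "'a set set \<Rightarrow> 'a list \<Rightarrow> bool" where
  "graph_cycle E vs \<longleftrightarrow> 3 \<le> length vs \<and> distinct vs \<and>
     (\<forall>i<length vs. {vs ! i, vs ! (Suc i mod length vs)} \<in> E)"

definition spanning_tree :: "'a set \<Rightarrow> 'a set set \<Rightarrow> 'a set set \<Rightarrow> bool" where
  "spanning_tree V E T \<longleftrightarrow> T \<subseteq> E \<and> graph_connected V T \<and> (\<nexists>vs. graph_cycle T vs)"

definition num_spanning_trees :: "'a set \<Rightarrow> 'a set set \<Rightarrow> nat" where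
  "num_spanning_trees V E = card {T. spanning_tree V E T}"

text \<open>
  Planarity is topological: \<open>p\<close> places the vertices in the plane \<open>complex\<close>, and \<open>\<gamma> e\<close> draws the
  edge \<open>e\<close> as a simple arc between its two endpoints, whose interior contains no vertex and no
  point of any other edge.
\<close>

definition plane_drawing ::
  "'a set \<Rightarrow> 'a set set \<Rightarrow> ('a \<Rightarrow> complex) \<Rightarrow> ('a set \<Rightarrow> real \<Rightarrow> complex) \<Rightarrow> bool" where
  "plane_drawing V E p \<gamma> \<longleftrightarrow> inj_on p V \<and>
     (\<forall>e\<in>E. arc (\<gamma> e) \<and> {pathstart (\<gamma> e), pathfinish (\<gamma> e)} = p ` e \<and>
        (path_image (\<gamma> e) - p ` e) \<inter> p ` V = {} \<and>
        (\<forall>f\<in>E. f \<noteq> e \<longrightarrow> (path_image (\<gamma> e) - p ` e) \<inter> path_image (\<gamma> f) = {}))"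

definition planar_graph :: "'a set \<Rightarrow> 'a set set \<Rightarrow> bool" where
  "planar_graph V E \<longleftrightarrow> (\<exists>p \<gamma>. plane_drawing V E p \<gamma>)"

end

theory Submission
  imports Defs "HOL-Number_Theory.Fib" "HOL-Computational_Algebra.Primes" "HOL-Real_Asymp.Real_Asymp"
begin

text \<open>
  Take two hubs and a path of \<open>q\<close> vertices, each joined to one of the hubs as prescribed by a bit string.
  If the hubs are identified, the number of spanning trees is the Fibonacci number \<open>H = fib (2 * q)\<close>,
  whatever the bits. If they are not, and the bit string is cut into a left part \<open>x\<close> and a right part
  \<open>y\<close>, the number of spanning trees has the form \<open>g x + h y - 2 * X x * X y\<close>, where \<open>X\<close> reads a bit
  string as a sum of distinct Fibonacci numbers of odd index. The functions \<open>g\<close> and \<open>h\<close> are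
  uncontrolled, but the bilinear term alone gives a power saving in the exponential sums modulo \<open>N\<close>
  as soon as the two parts have at least \<open>log 2 N\<close> bits.

  Forty such paths between the same hubs, together with an optional edge joining the hubs, have
  \<open>H ^ 39 * (T\<^sub>1 + \<dots> + T\<^sub>4\<^sub>0 + \<epsilon> * H)\<close> spanning trees. If \<open>H\<close> is coprime to \<open>N\<close>, this takes every
  residue: the savings add up to control all characters except the one of order two, on which the
  coefficient 2 acts trivially and which the optional edge cancels. A prime \<open>q = O(log N)\<close> with \<open>fib (2 * q)\<close>
  coprime to \<open>N\<close> exists by Chebyshev's estimate, since the numbers \<open>fib (2 * q)\<close> are pairwise coprime and
  \<open>N\<close> has few prime factors.
\<close>

section \<open>Counting spanning trees by deletion and contraction\<close>

abbreviation reach :: "'a set set \<Rightarrow> ('a \<times> 'a) set" where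
  "reach F \<equiv> {(a, b). {a, b} \<in> F}\<^sup>*"

lemma reach_sym: "(x, y) \<in> reach F \<Longrightarrow> (y, x) \<in> reach F"
proof (induction rule: rtrancl_induct)
  case (step y z)
  then have "(z, y) \<in> {(a, b). {a, b} \<in> F}" by (simp add: insert_commute)
  then show ?case using step.IH by (meson converse_rtrancl_into_rtrancl)
qed simp

lemma reach_mono: "F \<subseteq> G \<Longrightarrow> reach F \<subseteq> reach G"
  by (rule rtrancl_mono) auto

text \<open>A walk need use the new edge at most once. Thus adding an edge merges at most two
  components, which is what contraction does to vertex labels.\<close>

lemma reach_insert_iff:
  "(x, y) \<in> reach (insert {u, v} F) \<longleftrightarrow>
     (x, y) \<in> reach F \<or> ((x, u) \<in> reach F \<and> (v, y) \<in> reach F) \<or> ((x, v) \<in> reach F \<and> (u, y) \<in> reach F)"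
    (is "?L = ?R")
proof
  assume ?L
  then show ?R
  proof (induction rule: rtrancl_induct)
    case (step y z)
    then consider "{y, z} \<in> F" | "{y, z} = {u, v}" by auto
    then show ?case
    proof cases
      case 1
      then have "(y, z) \<in> {(a, b). {a, b} \<in> F}" by simp
      then show ?thesis using step.IH by (meson rtrancl.rtrancl_into_rtrancl)
    next
      case 2
      then have "y = u \<and> z = v \<or> y = v \<and> z = u" by (auto simp: doubleton_eq_iff)
      then show ?thesis using step.IH by (meson rtrancl.rtrancl_refl reach_sym rtrancl_trans)
    qed
  qed simp
next
  assume ?R
  have *: "reach F \<subseteq> reach (insert {u, v} F)" by (rule reach_mono) auto
  have "(u, v) \<in> reach (insert {u, v} F)" "(v, u) \<in> reach (insert {u, v} F)"
    by (auto intro!: r_into_rtrancl)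
  then show ?L using \<open>?R\<close> * by (meson rtrancl_trans subsetD)
qed

lemma graph_cycle_mono: "F \<subseteq> G \<Longrightarrow> graph_cycle F vs \<Longrightarrow> graph_cycle G vs"
  unfolding graph_cycle_def by blast

lemma reach_imp_path:
  assumes "(u, v) \<in> reach F"
  shows "\<exists>vs. vs \<noteq> [] \<and> distinct vs \<and> hd vs = u \<and> last vs = v \<and>
           (\<forall>i. Suc i < length vs \<longrightarrow> {vs ! i, vs ! Suc i} \<in> F)"
  using assms
proof (induction rule: rtrancl_induct)
  case base
  show ?case by (rule exI[of _ "[u]"]) auto
next
  case (step y z)
  then obtain vs where vs: "vs \<noteq> []" "distinct vs" "hd vs = u" "last vs = y"
    "\<forall>i. Suc i < length vs \<longrightarrow> {vs ! i, vs ! Suc i} \<in> F" by blast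
  show ?case
  proof (cases "z \<in> set vs")
    case True
    then obtain j where j: "j < length vs" "vs ! j = z" by (auto simp: in_set_conv_nth)
    let ?ws = "take (Suc j) vs"
    have "last ?ws = z" using j by (simp add: take_Suc_conv_app_nth)
    moreover have "hd ?ws = u" using vs(1,3) by (simp add: hd_take)
    ultimately show ?thesis using vs by (intro exI[of _ ?ws]) auto
  next
    case False
    let ?ws = "vs @ [z]"
    have "{?ws ! i, ?ws ! Suc i} \<in> F" if "Suc i < length ?ws" for i
    proof (cases "Suc i < length vs")
      case True
      then show ?thesis using vs(5) by (simp add: nth_append)
    next
      case False
      then have "i = length vs - 1" "Suc i = length vs" using that by auto
      then show ?thesis using vs(1,4) step.hyps(2) by (auto simp: nth_append last_conv_nth)
    qed
    then show ?thesis using vs False by (intro exI[of _ ?ws]) auto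
  qed
qed

lemma cycle_of_reach:
  assumes "(u, v) \<in> reach F" "u \<noteq> v" "{u, v} \<notin> F"
  shows "\<exists>vs. graph_cycle (insert {u, v} F) vs"
proof -
  obtain vs where vs: "vs \<noteq> []" "distinct vs" "hd vs = u" "last vs = v"
    "\<And>i. Suc i < length vs \<Longrightarrow> {vs ! i, vs ! Suc i} \<in> F"
    using reach_imp_path[OF assms(1)] by blast
  have n0: "vs ! 0 = u" "vs ! (length vs - 1) = v"
    using vs(1,3,4) by (auto simp: hd_conv_nth last_conv_nth)
  have "length vs \<noteq> 0" using vs(1) by simp
  moreover have "length vs \<noteq> 1" using n0 assms(2) by auto
  \<comment> \<open>A simple path on two vertices would be the edge \<open>{u, v}\<close> itself,
    which is not in \<open>F\<close>.\<close>
  moreover have "length vs \<noteq> 2"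
  proof
    assume "length vs = 2"
    then show False using vs(5)[of 0] n0 assms(3) by auto
  qed
  ultimately have len: "length vs \<ge> 3" by linarith
  have "{vs ! i, vs ! (Suc i mod length vs)} \<in> insert {u, v} F" if "i < length vs" for i
  proof (cases "Suc i < length vs")
    case False
    then have "Suc i = length vs" "i = length vs - 1" using that by auto
    then show ?thesis using n0 by (simp add: insert_commute)
  qed (use vs(5) in simp)
  then show ?thesis using len vs(2) unfolding graph_cycle_def by blast
qed

lemma graph_cycle_rotate:
  assumes "graph_cycle F vs"
  shows "graph_cycle F (rotate m vs)"
proof -
  let ?n = "length vs"
  have n: "?n \<ge> 3" using assms by (simp add: graph_cycle_def)
  have "{rotate m vs ! i, rotate m vs ! (Suc i mod ?n)} \<in> F" if "i < ?n" for i
  proof -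
    have "rotate m vs ! (Suc i mod ?n) = vs ! ((m + Suc i mod ?n) mod ?n)"
      using n by (intro nth_rotate mod_less_divisor) linarith
    also have "(m + Suc i mod ?n) mod ?n = Suc ((m + i) mod ?n) mod ?n"
      by (simp add: mod_simps)
    finally have 1: "rotate m vs ! (Suc i mod ?n) = vs ! (Suc ((m + i) mod ?n) mod ?n)" .
    have 2: "rotate m vs ! i = vs ! ((m + i) mod ?n)" using that by (rule nth_rotate)
    have "(m + i) mod ?n < ?n" using n by (intro mod_less_divisor) linarith
    then show ?thesis using assms unfolding graph_cycle_def 1 2 by blast
  qed
  then show ?thesis using assms by (auto simp: graph_cycle_def)
qed

text \<open>Since \<open>F\<close> is acyclic, the cycle uses the new edge. Rotating the list so
  that this edge joins its last entry to its first leaves a path inside \<open>F\<close>.\<close>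

lemma reach_of_cycle:
  assumes "graph_cycle (insert {u, v} F) vs" "\<nexists>vs. graph_cycle F vs"
  shows "(u, v) \<in> reach F"
proof -
  let ?n = "length vs" and ?G = "insert {u, v} F"
  have vs: "?n \<ge> 3" "distinct vs" "\<And>i. i < ?n \<Longrightarrow> {vs ! i, vs ! (Suc i mod ?n)} \<in> ?G"
    using assms(1) by (auto simp: graph_cycle_def)
  obtain i where i: "i < ?n" "{vs ! i, vs ! (Suc i mod ?n)} \<notin> F"
    using assms(2) vs(1,2) by (auto simp: graph_cycle_def)
  define ws where "ws = rotate (Suc i) vs"
  have len: "length ws = ?n" and dist: "distinct ws"
    using vs(2) by (auto simp: ws_def)
  have ws: "{ws ! j, ws ! (Suc j mod ?n)} \<in> ?G" if "j < ?n" for j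
    using graph_cycle_rotate[OF assms(1), of "Suc i"] that len
    unfolding graph_cycle_def ws_def by auto
  have ws0: "ws ! 0 = vs ! (Suc i mod ?n)"
    using vs(1) unfolding ws_def by (subst nth_rotate) auto
  have "(Suc i + (?n - 1)) mod ?n = i"
  proof -
    have "Suc i + (?n - 1) = i + ?n" using vs(1) by linarith
    then show ?thesis using i(1) by simp
  qed
  moreover have "?n - 1 < ?n" using vs(1) by linarith
  ultimately have wsl: "ws ! (?n - 1) = vs ! i"
    unfolding ws_def by (simp only: nth_rotate)
  have uv: "{ws ! (?n - 1), ws ! 0} = {u, v}"
    using i vs(3)[OF i(1)] ws0 wsl by auto
  have step: "{ws ! j, ws ! Suc j} \<in> F" if "Suc j < ?n" for j
  proof -
    \<comment> \<open>Distinct entries and length at least 3 keep the closing edge apart from the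
      others; with length 2 they would coincide.\<close>
    have "{ws ! j, ws ! Suc j} \<noteq> {ws ! (?n - 1), ws ! 0}"
    proof
      assume "{ws ! j, ws ! Suc j} = {ws ! (?n - 1), ws ! 0}"
      then consider "ws ! j = ws ! (?n - 1)" | "ws ! j = ws ! 0" "ws ! Suc j = ws ! (?n - 1)"
        by (auto simp: doubleton_eq_iff)
      then show False
      proof cases
        case 1
        then have "j = ?n - 1" using that len nth_eq_iff_index_eq[OF dist, of j "?n - 1"] by simp
        then show False using that by simp
      next
        case 2
        moreover have "vs \<noteq> []" using vs(1) by auto
        ultimately have "j = 0" using that len nth_eq_iff_index_eq[OF dist, of j 0] by simp
        moreover have "Suc j = ?n - 1"
          using 2(2) that len nth_eq_iff_index_eq[OF dist, of "Suc j" "?n - 1"] by simp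
        ultimately show False using vs(1) by simp
      qed
    qed
    then show ?thesis using ws[of j] that uv by auto
  qed
  have "(ws ! 0, ws ! j) \<in> reach F" if "j < ?n" for j
    using that
  proof (induction j)
    case (Suc j)
    then have "(ws ! j, ws ! Suc j) \<in> {(a, b). {a, b} \<in> F}" using step by simp
    then show ?case using Suc by (meson Suc_lessD rtrancl.rtrancl_into_rtrancl)
  qed simp
  then have "(ws ! 0, ws ! (?n - 1)) \<in> reach F" using vs(1) by simp
  then show ?thesis using uv reach_sym by (fastforce simp: doubleton_eq_iff)
qed

section \<open>The recursion and its correctness\<close>

abbreviation redirect :: "'a \<Rightarrow> 'a \<Rightarrow> 'a \<Rightarrow> 'a" where
  "redirect u v \<equiv> (\<lambda>x. if x = v then u else x)"

text \<open>The argument \<open>k\<close> is the number of vertices, which cannot be read off the edge list because of isolated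
  vertices. Contraction renames \<open>v\<close> to \<open>u\<close>; loops and parallel edges may arise.\<close>

function tree_count :: "('a \<times> 'a) list \<Rightarrow> nat \<Rightarrow> nat" where
  "tree_count [] k = (if k = 1 then 1 else 0)"
| "tree_count ((u, v) # es) k = tree_count es k +
     (if u = v then 0 else tree_count (map (map_prod (redirect u v) (redirect u v)) es) (k - 1))"
  by pat_completeness auto
termination by (relation "Wellfounded.measure (length \<circ> fst)") auto

abbreviation ends :: "'a \<times> 'a \<Rightarrow> 'a set" where
  "ends e \<equiv> {fst e, snd e}"

text \<open>Generalization for induction on the edge list: \<open>F\<close> is the forest of edges
  already contracted and \<open>\<phi>\<close> labels its components, so the relabelled list is the
  current contracted multigraph. The left-hand side counts the ways to complete \<open>F\<close> to
  a spanning tree.\<close>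

lemma tree_count_extend:
  assumes "finite V" "V \<noteq> {}"
    "distinct (map ends es)" "\<forall>e\<in>set es. fst e \<noteq> snd e \<and> ends e \<subseteq> V"
    "F \<inter> ends ` set es = {}" "\<nexists>vs. graph_cycle F vs"
    "\<forall>x\<in>V. \<forall>y\<in>V. \<phi> x = \<phi> y \<longleftrightarrow> (x, y) \<in> reach F"
  shows "card {T. T \<subseteq> ends ` set es \<and> graph_connected V (F \<union> T) \<and> (\<nexists>vs. graph_cycle (F \<union> T) vs)}
         = tree_count (map (map_prod \<phi> \<phi>) es) (card (\<phi> ` V))"
  using assms(3-)
proof (induction es arbitrary: F \<phi>)
  case Nil
  have "card (\<phi> ` V) = 1 \<longleftrightarrow> graph_connected V F"
  proof
    assume "card (\<phi> ` V) = 1"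
    then obtain z where "\<phi> ` V = {z}" by (auto simp: card_1_singleton_iff)
    then have "\<phi> x = \<phi> y" if "x \<in> V" "y \<in> V" for x y using that by (metis imageI singletonD)
    then show "graph_connected V F" unfolding graph_connected_def
      by (intro ballI) (rule Nil.prems(5)[rule_format, THEN iffD1])
  next
    assume *: "graph_connected V F"
    obtain x where "x \<in> V" using assms(2) by blast
    have c: "\<phi> y = \<phi> x" if "y \<in> V" for y
      using *[unfolded graph_connected_def, rule_format, OF that \<open>x \<in> V\<close>]
      by (rule Nil.prems(5)[rule_format, OF that \<open>x \<in> V\<close>, THEN iffD2])
    have "\<phi> ` V = {\<phi> x}"
    proof (intro equalityI subsetI)
      fix z assume "z \<in> \<phi> ` V"
      then obtain y where "y \<in> V" "z = \<phi> y" by (rule imageE)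
      then show "z \<in> {\<phi> x}" using c[of y] by (simp only: singleton_iff)
    next
      fix z assume "z \<in> {\<phi> x}"
      then show "z \<in> \<phi> ` V" using \<open>x \<in> V\<close> by (simp only: singleton_iff imageI)
    qed
    then show "card (\<phi> ` V) = 1" by simp
  qed
  moreover have "{T. T \<subseteq> ends ` set [] \<and> graph_connected V (F \<union> T) \<and> (\<nexists>vs. graph_cycle (F \<union> T) vs)}
     = {T. T = {} \<and> graph_connected V F}"
    (is "Collect ?P = Collect ?Q")
  proof (rule Collect_cong)
    fix T show "?P T \<longleftrightarrow> ?Q T"
      using Nil.prems(4) by (cases "T = {}") simp_all
  qed
  moreover have "{T. T = {} \<and> graph_connected V F} = (if graph_connected V F then {{}} else {})"
    by (simp add: Collect_conv_if)
  ultimately show ?case by (simp only: list.map tree_count.simps if_distrib[of card] card.empty) simp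
next
  case (Cons e es)
  obtain u v where e: "e = (u, v)" by (cases e)
  let ?ok = "\<lambda>F T. graph_connected V (F \<union> T) \<and> (\<nexists>vs. graph_cycle (F \<union> T) vs)"
  let ?A = "{T. T \<subseteq> ends ` set es \<and> ?ok F T}"
  let ?B = "{T. T \<subseteq> ends ` set es \<and> ?ok (insert {u, v} F) T}"
  have uv: "u \<noteq> v" "u \<in> V" "v \<in> V" using Cons.prems(2) by (auto simp: e)
  have enot: "{u, v} \<notin> ends ` set es" "{u, v} \<notin> F"
    using Cons.prems(1,3) by (auto simp: e)
  \<comment> \<open>Either the first edge is deleted, or it joins the forest and is removed from
    \<open>T\<close>.\<close>
  have split: "{T. T \<subseteq> ends ` set (e # es) \<and> ?ok F T} = ?A \<union> insert {u, v} ` ?B" (is "?C = _")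
  proof (intro equalityI subsetI)
    fix T assume T: "T \<in> ?C"
    show "T \<in> ?A \<union> insert {u, v} ` ?B"
    proof (cases "{u, v} \<in> T")
      case True
      then have "insert {u, v} F \<union> (T - {{u, v}}) = F \<union> T" by auto
      then have "T - {{u, v}} \<in> ?B" using T by (auto simp: e)
      moreover have "T = insert {u, v} (T - {{u, v}})" using True by auto
      ultimately show ?thesis by blast
    qed (use T in \<open>auto simp: e\<close>)
  next
    fix T assume "T \<in> ?A \<union> insert {u, v} ` ?B"
    then show "T \<in> ?C" by (auto simp: e)
  qed
  have fin: "finite ?A" "finite ?B"
    by (rule finite_subset[of _ "Pow (ends ` set es)"]; auto)+
  have inj: "inj_on (insert {u, v}) ?B"
    using enot(1) by (intro inj_onI) (metis (no_types, lifting) insert_ident mem_Collect_eq subsetD)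
  have "card ?C = card ?A + card (insert {u, v} ` ?B)"
    unfolding split using fin enot(1) by (intro card_Un_disjoint) auto
  also have "card (insert {u, v} ` ?B) = card ?B" using inj by (rule card_image)
  also have "card ?A = tree_count (map (map_prod \<phi> \<phi>) es) (card (\<phi> ` V))"
    using Cons.prems by (intro Cons.IH) auto
  also have "card ?B = (if \<phi> u = \<phi> v then 0 else
     tree_count (map (map_prod (redirect (\<phi> u) (\<phi> v) \<circ> \<phi>) (redirect (\<phi> u) (\<phi> v) \<circ> \<phi>)) es) (card (\<phi> ` V) - 1))"
  proof (cases "\<phi> u = \<phi> v")
    \<comment> \<open>The edge has become a loop: its ends lie in one component of \<open>F\<close>,
      so no acyclic extension contains it.\<close>
    case True
    then have "(u, v) \<in> reach F"
      by (rule Cons.prems(5)[rule_format, OF uv(2,3), THEN iffD1])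
    then obtain vs where "graph_cycle (insert {u, v} F) vs"
      using cycle_of_reach[OF _ uv(1) enot(2)] by blast
    then have "graph_cycle (insert {u, v} F \<union> T) vs" for T
      by (rule graph_cycle_mono[rotated]) auto
    then have "?B = {}" by blast
    then show ?thesis using True by simp
  next
    case False
    let ?\<psi> = "redirect (\<phi> u) (\<phi> v) \<circ> \<phi>"
    have nreach: "(u, v) \<notin> reach F"
      using Cons.prems(5)[rule_format, OF uv(2,3)] False by simp
    have acyc: "\<nexists>vs. graph_cycle (insert {u, v} F) vs"
      using reach_of_cycle[OF _ Cons.prems(4), of u v] nreach by blast
    have lab: "?\<psi> x = ?\<psi> y \<longleftrightarrow> (x, y) \<in> reach (insert {u, v} F)" if "x \<in> V" "y \<in> V" for x y
    proof -
      have "(x, y) \<in> reach F \<longleftrightarrow> \<phi> x = \<phi> y" "(x, u) \<in> reach F \<longleftrightarrow> \<phi> x = \<phi> u"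
        "(v, y) \<in> reach F \<longleftrightarrow> \<phi> v = \<phi> y" "(x, v) \<in> reach F \<longleftrightarrow> \<phi> x = \<phi> v"
        "(u, y) \<in> reach F \<longleftrightarrow> \<phi> u = \<phi> y"
        by (rule Cons.prems(5)[rule_format, symmetric]; use uv that in simp)+
      then show ?thesis unfolding reach_insert_iff by (simp only: comp_def; metis (full_types))
    qed
    \<comment> \<open>Exactly the label \<open>\<phi> v\<close> disappears, which accounts for
      \<open>k - 1\<close> in the recursion.\<close>
    have "?\<psi> ` V = \<phi> ` V - {\<phi> v}" using uv False by (auto simp: image_iff)
    then have "card (?\<psi> ` V) = card (\<phi> ` V) - 1" using uv assms(1) by simp
    moreover have "card ?B = tree_count (map (map_prod ?\<psi> ?\<psi>) es) (card (?\<psi> ` V))"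
      using Cons.prems enot acyc lab by (intro Cons.IH) auto
    ultimately show ?thesis using False by simp
  qed
  finally show ?case by (simp add: e map_prod_compose)
qed

lemma num_spanning_trees_eq_tree_count:
  assumes "finite V" "V \<noteq> {}" "distinct (map ends es)"
    "\<forall>e\<in>set es. fst e \<noteq> snd e \<and> ends e \<subseteq> V"
  shows "num_spanning_trees V (ends ` set es) = tree_count es (card V)"
proof -
  have "reach {} = (Id :: ('a \<times> 'a) set)" by auto
  moreover have "\<nexists>vs. graph_cycle {} vs" by (auto simp: graph_cycle_def intro!: exI[of _ 0])
  ultimately show ?thesis
    using tree_count_extend[OF assms, of "{}" "\<lambda>x. x"]
    by (simp add: num_spanning_trees_def spanning_tree_def map_prod_def)
qed

section \<open>Fans\<close>

text \<open>With \<open>k\<close> vertices, some vertex lies outside \<open>S\<close> and is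
  isolated. Contraction lowers both sides of the inequality by one, so the excess persists.\<close>

lemma tree_count_eq_0:
  assumes "finite S" "S \<noteq> {}" "fst ` set es \<union> snd ` set es \<subseteq> S" "card S < k"
  shows "tree_count es k = 0"
  using assms
proof (induction es k arbitrary: S rule: tree_count.induct)
  case (1 k)
  then have "card S > 0" by (simp add: card_gt_0_iff)
  then show ?case using 1 by simp
next
  case (2 u v es k)
  have "tree_count es k = 0" using 2 by simp
  moreover have "tree_count (map (map_prod (redirect u v) (redirect u v)) es) (k - 1) = 0" if "u \<noteq> v"
  proof -
    have "card S > 0" using 2 by (simp add: card_gt_0_iff)
    then have "card (S - {v}) < k - 1" using 2 that by (simp add: card_Diff_singleton)
    moreover have "S - {v} \<noteq> {}" using 2 that by auto
    ultimately show ?thesis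
      using 2(2)[OF that, of "S - {v}"] 2 that by (auto simp: image_image image_subset_iff)
  qed
  ultimately show ?case by simp
qed

text \<open>A path \<open>a, n, n + 1, \<dots>\<close> with hubs \<open>b\<close> and \<open>c\<close>. The last vertex is a leaf without hub: it does not
  change the number of spanning trees, and it makes the recursion uniform.\<close>

fun fan :: "bool list \<Rightarrow> nat \<Rightarrow> nat \<Rightarrow> nat \<Rightarrow> nat \<Rightarrow> (nat \<times> nat) list" where
  "fan [] a n b c = []"
| "fan (d # ds) a n b c = (if d then b else c, a) # (a, n) # fan ds n (Suc n) b c"

lemma map_fan:
  "(\<And>x. n \<le> x \<Longrightarrow> s x = x) \<Longrightarrow>
     map (map_prod s s) (fan ds a n b c) = fan ds (s a) n (s b) (s c)"
  by (induction ds a n b c rule: fan.induct) auto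

lemma set_fan:
  "(x, y) \<in> set (fan ds a n b c) \<Longrightarrow> {x, y} \<subseteq> {a, b, c} \<union> {n..<n + length ds}"
  by (induction ds a n b c rule: fan.induct) (auto split: if_splits)

text \<open>The letter \<open>H\<close> counts spanning forests separating the two hubs, \<open>T\<close> those connecting them. The
  digit 0 means that the first path vertex is free, 1 that it is already identified with a hub, namely
  \<open>b\<close> or \<open>c\<close> according to the bit \<open>e\<close> in \<open>fanT1 e\<close>.\<close>

fun fanH1 :: "nat \<Rightarrow> nat" and fanH0 :: "nat \<Rightarrow> nat" where
  "fanH0 0 = 0" | "fanH1 0 = 1"
| "fanH0 (Suc n) = 2 * fanH0 n + fanH1 n"
| "fanH1 (Suc n) = fanH0 n + fanH1 n"

fun fanT0 :: "bool list \<Rightarrow> nat" and fanT1 :: "bool \<Rightarrow> bool list \<Rightarrow> nat" where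
  "fanT0 [] = 0" | "fanT1 e [] = 0"
| "fanT0 (d # ds) = 2 * fanT0 ds + fanT1 d ds"
| "fanT1 e (d # ds) = fanT0 ds + fanT1 e ds +
     (if d = e then 0 else fanH0 (length ds) + fanH1 (length ds))"

text \<open>The remaining edges \<open>rest b c\<close> enter the recursion only through their number of spanning trees
  with the hubs identified (\<open>X1\<close>) and with the hubs distinct (\<open>X2\<close>).\<close>

locale fan_rest =
  fixes rest :: "nat \<Rightarrow> nat \<Rightarrow> (nat \<times> nat) list" and M M' b c X1 X2 :: nat
  assumes map_rest: "\<And>s x y. (\<And>z. M \<le> z \<Longrightarrow> s z = z) \<Longrightarrow>
      map (map_prod s s) (rest x y) = rest (s x) (s y)"
    and set_rest: "\<And>x y. fst ` set (rest x y) \<union> snd ` set (rest x y) \<subseteq> {x, y} \<union> {M..<M'}"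
    and le: "M \<le> M'" and bc: "b \<noteq> c"
    and X1: "\<And>h. h = b \<or> h = c \<Longrightarrow> tree_count (rest h h) (Suc (M' - M)) = X1"
    and X2: "tree_count (rest b c) (M' - M + 2) = X2"
begin

lemma too_many_components:
  assumes "finite A" "{x, y} \<subseteq> A" "fst ` set es \<union> snd ` set es \<subseteq> A" "card A + (M' - M) < k"
  shows "tree_count (es @ rest x y) k = 0"
proof (rule tree_count_eq_0)
  show "fst ` set (es @ rest x y) \<union> snd ` set (es @ rest x y) \<subseteq> A \<union> {M..<M'}"
    using assms(2,3) set_rest[of x y] by (simp add: image_Un) blast
  have "card (A \<union> {M..<M'}) \<le> card A + card {M..<M'}" by (rule card_Un_le)
  then show "card (A \<union> {M..<M'}) < k" using assms(4) by simp
qed (use assms in auto)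

text \<open>Disposes of the branch in which both edges at the current path vertex are
  deleted.\<close>

lemma isolated_vertex_fan:
  assumes "card {n, x, y} + (M' - M) + length ds < k"
  shows "tree_count (fan ds n (Suc n) x y @ rest x y) k = 0"
proof (rule too_many_components)
  let ?A = "{n, x, y} \<union> {Suc n..<Suc n + length ds}"
  show "fst ` set (fan ds n (Suc n) x y) \<union> snd ` set (fan ds n (Suc n) x y) \<subseteq> ?A"
    using set_fan[of _ _ ds n "Suc n" x y] by fastforce
  have "card ?A \<le> card {n, x, y} + card {Suc n..<Suc n + length ds}" by (rule card_Un_le)
  then show "card ?A + (M' - M) < k" using assms by simp
qed auto

lemma map_fan_rest:
  assumes "y < n" "n + length ds \<le> M"
  shows "map (map_prod (redirect x y) (redirect x y)) (fan ds z n v w @ rest v w)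
        = fan ds (redirect x y z) n (redirect x y v) (redirect x y w) @ rest (redirect x y v) (redirect x y w)"
  using assms map_fan[of n "redirect x y"] map_rest[of "redirect x y"] by auto

text \<open>Once the hubs are identified, the fan and the rest meet in the single vertex
  \<open>h\<close>, so the counts multiply. Processing the spoke and the path edge at the first
  vertex yields the recurrences of \<open>fanH0\<close> and \<open>fanH1\<close>.\<close>

lemma tree_count_fan_merged:
  assumes "h = b \<or> h = c" "h < n" "n + length ds \<le> M"
  shows "a < n \<Longrightarrow> a \<noteq> h \<Longrightarrow>
      tree_count (fan ds a n h h @ rest h h) (M' - M + 2 + length ds) = fanH0 (length ds) * X1" (is "_ \<Longrightarrow> _ \<Longrightarrow> ?P0 ds a n")
    and "tree_count (fan ds h n h h @ rest h h) (Suc (M' - M + length ds)) = fanH1 (length ds) * X1" (is "?P1 ds n")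
proof -
  have "(\<forall>a<n. a \<noteq> h \<longrightarrow> ?P0 ds a n) \<and> ?P1 ds n"
    using assms(2,3)
  proof (induction ds arbitrary: n)
    case Nil
    have "tree_count ([] @ rest h h) (M' - M + 2) = 0" by (rule too_many_components[of "{h}"]) auto
    then show ?case using X1[OF assms(1)] by simp
  next
    case (Cons d ds)
    have IH: "\<forall>a<Suc n. a \<noteq> h \<longrightarrow> ?P0 ds a (Suc n)" "?P1 ds (Suc n)"
      using Cons.IH[of "Suc n"] Cons.prems by auto
    have IH0: "?P0 ds a (Suc n)" if "a < Suc n" "a \<noteq> h" for a using IH(1) that by blast
    have "?P0 (d # ds) a n" if a: "a < n" "a \<noteq> h" for a
    proof -
      have "tree_count (fan ds n (Suc n) h h @ rest h h) (M' - M + 2 + length (d # ds)) = 0"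
        using Cons.prems by (intro isolated_vertex_fan) (simp add: card_insert_if)
      then show ?thesis
        using a Cons.prems IH(2) IH0[of n] IH0[of a]
        by (simp add: map_fan_rest algebra_simps del: map_append map_map)
    qed
    moreover have "?P1 (d # ds) n"
      using Cons.prems IH(2) IH0[of n] by (simp add: map_fan_rest algebra_simps del: map_append map_map)
    ultimately show ?case by blast
  qed
  then show "a < n \<Longrightarrow> a \<noteq> h \<Longrightarrow> ?P0 ds a n" "?P1 ds n" by auto
qed

text \<open>A spanning tree connects the hubs either inside the fan, and the rest then sees them as
  identified, or outside it, and the fan part is a forest separating them.\<close>

lemma tree_count_fan:
  assumes "b < n" "c < n" "n + length ds \<le> M"
  shows "a < n \<Longrightarrow> a \<noteq> b \<Longrightarrow> a \<noteq> c \<Longrightarrow>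
      tree_count (fan ds a n b c @ rest b c) (M' - M + 3 + length ds) = fanT0 ds * X1 + fanH0 (length ds) * X2"
      (is "_ \<Longrightarrow> _ \<Longrightarrow> _ \<Longrightarrow> ?P0 ds a n")
    and "tree_count (fan ds (if e then b else c) n b c @ rest b c) (M' - M + 2 + length ds)
      = fanT1 e ds * X1 + fanH1 (length ds) * X2" (is "?P1 e ds n")
proof -
  have "(\<forall>a<n. a \<noteq> b \<longrightarrow> a \<noteq> c \<longrightarrow> ?P0 ds a n) \<and> ?P1 True ds n \<and> ?P1 False ds n"
    using assms
  proof (induction ds arbitrary: n)
    case Nil
    have "tree_count ([] @ rest b c) (M' - M + 3) = 0"
      using bc by (intro too_many_components[of "{b, c}"]) auto
    then show ?case using X2 by simp
  next
    case (Cons d ds)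
    have IH: "\<forall>a<Suc n. a \<noteq> b \<longrightarrow> a \<noteq> c \<longrightarrow> ?P0 ds a (Suc n)" "?P1 True ds (Suc n)" "?P1 False ds (Suc n)"
      using Cons.IH[of "Suc n"] Cons.prems by auto
    have IH0: "?P0 ds a (Suc n)" if "a < Suc n" "a \<noteq> b" "a \<noteq> c" for a using IH(1) that by blast
    have "?P0 (d # ds) a n" if a: "a < n" "a \<noteq> b" "a \<noteq> c" for a
    proof -
      have "tree_count (fan ds n (Suc n) b c @ rest b c) (M' - M + 3 + length (d # ds)) = 0"
        using Cons.prems by (intro isolated_vertex_fan) (simp add: card_insert_if)
      then show ?thesis
        using a Cons.prems IH(2,3) IH0[of n] IH0[of a]
        by (cases d) (simp_all add: map_fan_rest algebra_simps numeral_eq_Suc del: map_append map_map)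
    qed
    \<comment> \<open>Contracting a spoke from one hub to a vertex already identified with the other
      merges the hubs; the merged counts then supply the extra summand of
      \<open>fanT1\<close>.\<close>
    moreover have "?P1 e (d # ds) n" for e
      using Cons.prems IH(2,3) IH0[of n] bc tree_count_fan_merged(1)[of b "Suc n" ds n] tree_count_fan_merged(1)[of c "Suc n" ds n]
        tree_count_fan_merged(2)[of b "Suc n" ds] tree_count_fan_merged(2)[of c "Suc n" ds]
      by (cases d; cases e)
        (simp_all add: map_fan_rest algebra_simps numeral_eq_Suc del: map_append map_map)
    ultimately show ?case by blast
  qed
  then show "a < n \<Longrightarrow> a \<noteq> b \<Longrightarrow> a \<noteq> c \<Longrightarrow> ?P0 ds a n" "?P1 e ds n" by (cases e; simp)+
qed

end

section \<open>Several fans between the same hubs\<close>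

fun fans :: "bool \<Rightarrow> bool list list \<Rightarrow> nat \<Rightarrow> nat \<Rightarrow> nat \<Rightarrow> (nat \<times> nat) list" where
  "fans \<epsilon> [] n b c = (if \<epsilon> then [(b, c)] else [])"
| "fans \<epsilon> (ds # dss) n b c = fan ds n (Suc n) b c @ fans \<epsilon> dss (n + Suc (length ds)) b c"

abbreviation fans_size :: "bool list list \<Rightarrow> nat" where
  "fans_size dss \<equiv> sum_list (map (\<lambda>ds. Suc (length ds)) dss)"

lemma map_fans:
  "(\<And>x. n \<le> x \<Longrightarrow> s x = x) \<Longrightarrow> map (map_prod s s) (fans \<epsilon> dss n b c) = fans \<epsilon> dss n (s b) (s c)"
  by (induction \<epsilon> dss n b c rule: fans.induct) (auto simp: map_fan)

lemma set_fans:
  "(x, y) \<in> set (fans \<epsilon> dss n b c) \<Longrightarrow> {x, y} \<subseteq> {b, c} \<union> {n..<n + fans_size dss}"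
  by (induction \<epsilon> dss n b c rule: fans.induct) (fastforce split: if_splits dest: set_fan)+

text \<open>The rule for two-terminal graphs in parallel: separating forests multiply, and a tree
  connects the terminals in exactly one of the two components.\<close>

fun fansT :: "bool \<Rightarrow> bool list list \<Rightarrow> nat" and fansH :: "bool list list \<Rightarrow> nat" where
  "fansT \<epsilon> [] = of_bool \<epsilon>" | "fansH [] = 1"
| "fansT \<epsilon> (ds # dss) = fanT0 ds * fansH dss + fanH0 (length ds) * fansT \<epsilon> dss"
| "fansH (ds # dss) = fanH0 (length ds) * fansH dss"

lemma tree_count_fans:
  assumes "b < n" "c < n" "b \<noteq> c"
  shows "tree_count (fans \<epsilon> dss n b c) (fans_size dss + 2) = fansT \<epsilon> dss"
proof -
  \<comment> \<open>The count with identified hubs is carried along because the later fans serve as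
    \<open>rest\<close> in \<open>fan_rest\<close>, which needs both counts.\<close>
  have "tree_count (fans \<epsilon> dss n b c) (fans_size dss + 2) = fansT \<epsilon> dss \<and>
    (\<forall>h. h = b \<or> h = c \<longrightarrow> tree_count (fans \<epsilon> dss n h h) (Suc (fans_size dss)) = fansH dss)"
    using assms
  proof (induction dss arbitrary: n)
    case Nil
    then show ?case by simp
  next
    case (Cons ds dss)
    let ?M = "n + Suc (length ds)"
    have IH: "tree_count (fans \<epsilon> dss ?M b c) (fans_size dss + 2) = fansT \<epsilon> dss"
      "h = b \<or> h = c \<Longrightarrow> tree_count (fans \<epsilon> dss ?M h h) (Suc (fans_size dss)) = fansH dss" for h
      using Cons.IH[of ?M] Cons.prems by auto
    interpret fan_rest "fans \<epsilon> dss ?M" ?M "?M + fans_size dss" b c "fansH dss" "fansT \<epsilon> dss"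
    proof
      show "fst ` set (fans \<epsilon> dss ?M x y) \<union> snd ` set (fans \<epsilon> dss ?M x y)
          \<subseteq> {x, y} \<union> {?M..<?M + fans_size dss}" for x y
        using set_fans[of _ _ \<epsilon> dss ?M x y] by fastforce
    qed (use Cons.prems IH map_fans in \<open>auto simp del: fans.simps\<close>)
    show ?case
      using tree_count_fan(1)[of "Suc n" ds n] tree_count_fan_merged(1)[of b "Suc n" ds n] tree_count_fan_merged(1)[of c "Suc n" ds n] Cons.prems
      by (auto simp: algebra_simps numeral_eq_Suc)
  qed
  then show ?thesis by blast
qed

section \<open>A planar drawing\<close>

text \<open>Vertices 0 and 1 are the hubs, at \<open>\<i>\<close> and \<open>- \<i>\<close>; all
  path vertices of all fans lie on the positive real axis. Every edge is drawn as a straight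
  segment.\<close>

definition hub_pos :: "nat \<Rightarrow> complex" where
  "hub_pos n = (if n = 0 then \<i> else if n = 1 then - \<i> else of_nat n)"

definition fan_edge :: "nat \<Rightarrow> nat \<Rightarrow> bool" where
  "fan_edge x y \<longleftrightarrow> x = 0 \<and> y = 1 \<or> x < 2 \<and> 2 \<le> y \<or> 2 \<le> x \<and> y = Suc x"

lemma inj_hub_pos: "inj hub_pos"
  by (intro injI) (auto simp: hub_pos_def complex_eq_iff split: if_splits)

lemma fan_segment:
  assumes "fan_edge x y" "z \<in> closed_segment (hub_pos x) (hub_pos y)"
  shows "x = 0 \<and> y = 1 \<and> Re z = 0 \<or>
    x = 0 \<and> 2 \<le> y \<and> Re z = y * (1 - Im z) \<and> 0 \<le> Im z \<or>
    x = 1 \<and> 2 \<le> y \<and> Re z = y * (1 + Im z) \<and> Im z \<le> 0 \<or>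
    2 \<le> x \<and> y = Suc x \<and> Im z = 0 \<and> x \<le> Re z \<and> Re z \<le> x + 1"
proof -
  obtain u where u: "0 \<le> u" "u \<le> 1" "z = (1 - u) *\<^sub>R hub_pos x + u *\<^sub>R hub_pos y"
    using assms(2) by (auto simp: in_segment)
  then have z: "Re z = (1 - u) * Re (hub_pos x) + u * Re (hub_pos y)"
    "Im z = (1 - u) * Im (hub_pos x) + u * Im (hub_pos y)" by simp_all
  consider "x = 0" "y = 1" | "x = 0" "2 \<le> y" | "x = 1" "2 \<le> y" | "2 \<le> x" "y = Suc x"
    using assms(1) by (auto simp: fan_edge_def less_2_cases_iff)
  then show ?thesis
  proof cases
    case 2
    then have "Re z = u * real y" "u = 1 - Im z" using z by (simp_all add: hub_pos_def)
    then show ?thesis using 2 u(1,2) by (simp add: mult.commute)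
  next
    case 3
    then have "Re z = u * real y" "u = 1 + Im z" using z by (simp_all add: hub_pos_def)
    then show ?thesis using 3 u(1,2) by (simp add: mult.commute)
  next
    case 4
    then have "Re z = real x + u" "Im z = 0" using z by (simp_all add: hub_pos_def algebra_simps)
    then show ?thesis using 4 u(1,2) by simp
  qed (use z in \<open>simp add: hub_pos_def\<close>)
qed

text \<open>Distinct spokes of one hub meet only in that hub, spokes of opposite hubs can meet only
  on the real axis, hence in a path vertex, and path edges overlap at most in an end.\<close>

lemma fan_segments_inter:
  assumes "fan_edge x y" "fan_edge x' y'" "(x, y) \<noteq> (x', y')"
    "z \<in> closed_segment (hub_pos x) (hub_pos y)" "z \<in> closed_segment (hub_pos x') (hub_pos y')"
  shows "z = hub_pos x \<or> z = hub_pos y"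
proof -
  \<comment> \<open>The value \<open>n = 0\<close> covers the edge between the hubs, which lies on
    the imaginary axis.\<close>
  have top: "z = hub_pos 0" if "Re z = real n * (1 - Im z)" "Re z = real m * (1 - Im z)" "n \<noteq> m" for n m
  proof -
    have "(real n - real m) * (1 - Im z) = 0" unfolding left_diff_distrib using that(1,2) by linarith
    then have "Im z = 1" using that(3) by auto
    then show ?thesis using that(1) by (simp add: hub_pos_def complex_eq_iff)
  qed
  have bot: "z = hub_pos 1" if "Re z = real n * (1 + Im z)" "Re z = real m * (1 + Im z)" "n \<noteq> m" for n m
  proof -
    have "(real n - real m) * (1 + Im z) = 0" unfolding left_diff_distrib using that(1,2) by linarith
    then have "1 + Im z = 0" using that(3) by auto
    then show ?thesis using that(1) by (simp add: hub_pos_def complex_eq_iff)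
  qed
  have mid: "z = hub_pos n" if "Re z = real n" "Im z = 0" "2 \<le> n" for n
    using that by (simp add: hub_pos_def complex_eq_iff)
  have int: "n = k \<or> n = Suc k" if "real k \<le> real n" "real n \<le> real k + 1" for n k
    using that by linarith
  consider "x = 0" "y = 1" "Re z = 0"
    | "x = 0" "2 \<le> y" "Re z = real y * (1 - Im z)" "0 \<le> Im z"
    | "x = 1" "2 \<le> y" "Re z = real y * (1 + Im z)" "Im z \<le> 0"
    | "2 \<le> x" "y = Suc x" "Im z = 0" "real x \<le> Re z" "Re z \<le> real x + 1"
    using fan_segment[OF assms(1,4)] by blast
  note c1 = this
  consider "x' = 0" "y' = 1" "Re z = 0"
    | "x' = 0" "2 \<le> y'" "Re z = real y' * (1 - Im z)" "0 \<le> Im z"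
    | "x' = 1" "2 \<le> y'" "Re z = real y' * (1 + Im z)" "Im z \<le> 0"
    | "2 \<le> x'" "y' = Suc x'" "Im z = 0" "real x' \<le> Re z" "Re z \<le> real x' + 1"
    using fan_segment[OF assms(2,5)] by blast
  note c2 = this
  from c1 show ?thesis
  proof cases
    case 1
    from c2 show ?thesis
    proof cases
      case 1
      then show ?thesis using \<open>x = 0\<close> \<open>y = 1\<close> assms(3) by simp
    next
      case 2
      then show ?thesis using 1 top[of 0 y'] by simp
    next
      case 3
      then show ?thesis using 1 bot[of 0 y'] by simp
    next
      case 4
      then show ?thesis using 1 by linarith
    qed
  next
    case 2
    note h = 2
    from c2 show ?thesis
    proof cases
      case 1
      then show ?thesis using h top[of 0 y] by simp
    next
      case 2
      then show ?thesis using h top[of y y'] assms(3) by auto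
    next
      case 3
      then have "Im z = 0" using h by linarith
      then show ?thesis using h mid[of y] by simp
    next
      case 4
      then show ?thesis using h mid[of y] by simp
    qed
  next
    case 3
    note h = 3
    from c2 show ?thesis
    proof cases
      case 1
      then show ?thesis using h bot[of 0 y] by simp
    next
      case 2
      then have "Im z = 0" using h by linarith
      then show ?thesis using h mid[of y] by simp
    next
      case 3
      then show ?thesis using h bot[of y y'] assms(3) by auto
    next
      case 4
      then show ?thesis using h mid[of y] by simp
    qed
  next
    case 4
    note h = 4
    from c2 show ?thesis
    proof cases
      case 1
      then show ?thesis using h by linarith
    next
      case 2
      then have "Re z = real y'" using h by simp
      then show ?thesis using h int[of x y'] mid[of y'] 2 by auto
    next
      case 3
      then have "Re z = real y'" using h by simp
      then show ?thesis using h int[of x y'] mid[of y'] 3 by auto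
    next
      case 4
      have "x \<noteq> x'" using h 4 assms(3) by auto
      then have "Re z = real x \<or> Re z = real (Suc x)" using h 4 by (cases "x < x'") auto
      then show ?thesis using h mid[of x] mid[of "Suc x"] by auto
    qed
  qed
qed

lemma fan_segment_vertex:
  assumes "fan_edge x y" "hub_pos v \<in> closed_segment (hub_pos x) (hub_pos y)"
  shows "v = x \<or> v = y"
  using fan_segment[OF assms] assms(1)
  by (auto simp: hub_pos_def fan_edge_def split: if_splits)

lemma planar_fan_edges:
  assumes "\<And>e. e \<in> E \<Longrightarrow> \<exists>x y. fan_edge x y \<and> e = {x, y}"
  shows "planar_graph V E"
proof -
  \<comment> \<open>Edges are unordered, but \<open>fan_edge x y\<close> implies
    \<open>x < y\<close>, so \<open>Min\<close> and \<open>Max\<close> recover the ends.\<close>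
  define \<gamma> where "\<gamma> e = linepath (hub_pos (Min e)) (hub_pos (Max e))" for e
  have lt: "x < y" if "fan_edge x y" for x y using that by (auto simp: fan_edge_def)
  have \<gamma>: "\<gamma> {x, y} = linepath (hub_pos x) (hub_pos y)" if "fan_edge x y" for x y
    using lt[OF that] by (simp add: \<gamma>_def)
  have "arc (\<gamma> e) \<and> {pathstart (\<gamma> e), pathfinish (\<gamma> e)} = hub_pos ` e \<and>
        (path_image (\<gamma> e) - hub_pos ` e) \<inter> hub_pos ` V = {} \<and>
        (\<forall>f\<in>E. f \<noteq> e \<longrightarrow> (path_image (\<gamma> e) - hub_pos ` e) \<inter> path_image (\<gamma> f) = {})" if e: "e \<in> E" for e
  proof -
    obtain x y where xy: "fan_edge x y" "e = {x, y}" using assms[OF e] by blast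
    have "hub_pos x \<noteq> hub_pos y" using lt[OF xy(1)] inj_hub_pos by (auto dest: injD)
    then have "arc (\<gamma> e)" by (simp add: xy(2) \<gamma>[OF xy(1)])
    moreover have "(path_image (\<gamma> e) - hub_pos ` e) \<inter> hub_pos ` V = {}"
      using fan_segment_vertex[OF xy(1)] by (auto simp: xy(2) \<gamma>[OF xy(1)])
    moreover have "(path_image (\<gamma> e) - hub_pos ` e) \<inter> path_image (\<gamma> f) = {}" if f: "f \<in> E" "f \<noteq> e" for f
    proof -
      obtain x' y' where xy': "fan_edge x' y'" "f = {x', y'}" using assms[OF f(1)] by blast
      then have "(x, y) \<noteq> (x', y')" using f(2) xy(2) by auto
      then show ?thesis
        using fan_segments_inter[OF xy(1) xy'(1)] by (auto simp: xy(2) xy'(2) \<gamma>[OF xy(1)] \<gamma>[OF xy'(1)])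
    qed
    ultimately show ?thesis by (simp add: xy(2) \<gamma>[OF xy(1)])
  qed
  then have "plane_drawing V E hub_pos \<gamma>"
    unfolding plane_drawing_def using inj_hub_pos by (auto intro: inj_on_subset)
  then show ?thesis unfolding planar_graph_def by blast
qed

section \<open>Dependence on the bits\<close>

lemma fanH_fib: "fanH0 n = fib (2 * n)" "fanH0 n + fanH1 n = fib (2 * n + 1)"
proof -
  have "fanH0 n = fib (2 * n) \<and> fanH0 n + fanH1 n = fib (2 * n + 1)"
    by (induction n) auto
  then show "fanH0 n = fib (2 * n)" "fanH0 n + fanH1 n = fib (2 * n + 1)" by auto
qed

fun fib_val :: "bool list \<Rightarrow> nat" where
  "fib_val [] = 0"
| "fib_val (d # ds) = (if d then fib (2 * length ds + 1) else 0) + fib_val ds"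

text \<open>The summand \<open>fanT0 ds\<close> cancels, so each bit contributes an odd-indexed
  Fibonacci number with a sign. Taken together these numbers add up to
  \<open>fib (2 * length ds)\<close>.\<close>

lemma fanT1_diff:
  "int (fanT1 True ds) - int (fanT1 False ds) = int (fib (2 * length ds)) - 2 * int (fib_val ds)"
proof (induction ds)
  case (Cons d ds)
  have "fib (2 * length (d # ds)) = fib (2 * length ds) + fib (2 * length ds + 1)" by simp
  then show ?case using Cons fanH_fib(2)[of "length ds"] by auto
qed simp

text \<open>The left part acts affinely on the three values attached to \<open>ys\<close>. It is
  reversed so that the induction inserts each new bit next to \<open>ys\<close>; \<open>r\<close>
  depends on \<open>xs\<close> and on the length of \<open>ys\<close> only.\<close>

lemma fanT0_rev_append:
  "\<exists>r. \<forall>ys. length ys = n \<longrightarrow> int (fanT0 (rev xs @ ys)) = r + int (fib (2 * length xs + 1)) * int (fanT0 ys)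
     + int (fib_val xs) * int (fanT1 True ys)
     + (int (fib (2 * length xs)) - int (fib_val xs)) * int (fanT1 False ys)"
proof (induction xs arbitrary: n)
  case Nil
  show ?case by simp
next
  case (Cons x xs)
  obtain r where r: "int (fanT0 (rev xs @ ys)) = r + int (fib (2 * length xs + 1)) * int (fanT0 ys)
     + int (fib_val xs) * int (fanT1 True ys)
     + (int (fib (2 * length xs)) - int (fib_val xs)) * int (fanT1 False ys)" if "length ys = Suc n" for ys
    using Cons.IH[of "Suc n"] by blast
  let ?D = "int (fanH0 n + fanH1 n)"
  \<comment> \<open>For the bit \<open>x\<close>, only the \<open>fanT1\<close> value of the other
    hub gains \<open>?D\<close>, so \<open>?D\<close> is weighted by the coefficient of that
    value.\<close>
  let ?r = "r + (if x then int (fib (2 * length xs)) - int (fib_val xs) else int (fib_val xs)) * ?D"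
  show ?case
  proof (rule exI[of _ ?r], intro allI impI)
    fix ys :: "bool list" assume "length ys = n"
    then show "int (fanT0 (rev (x # xs) @ ys)) = ?r + int (fib (2 * length (x # xs) + 1)) * int (fanT0 ys)
     + int (fib_val (x # xs)) * int (fanT1 True ys)
     + (int (fib (2 * length (x # xs))) - int (fib_val (x # xs))) * int (fanT1 False ys)"
      using r[of "x # ys"] by (cases x) (simp_all add: algebra_simps)
  qed
qed

text \<open>The coefficients of the two \<open>fanT1\<close> values add up to a constant.
  Eliminating one of them by their difference therefore leaves a single term involving both
  parts.\<close>

lemma fanT0_bilinear:
  "\<exists>g h. \<forall>xs ys. length xs = k \<longrightarrow> length ys = n \<longrightarrow>
     int (fanT0 (rev xs @ ys)) = g xs + h ys - 2 * int (fib_val xs) * int (fib_val ys)"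
proof -
  obtain r where r: "\<And>xs ys. length ys = n \<Longrightarrow>
     int (fanT0 (rev xs @ ys)) = r xs + int (fib (2 * length xs + 1)) * int (fanT0 ys)
     + int (fib_val xs) * int (fanT1 True ys)
     + (int (fib (2 * length xs)) - int (fib_val xs)) * int (fanT1 False ys)"
    using fanT0_rev_append[of n] by metis
  have "int (fanT0 (rev xs @ ys)) = (r xs + int (fib_val xs) * int (fib (2 * n)))
     + (int (fib (2 * k + 1)) * int (fanT0 ys) + int (fib (2 * k)) * int (fanT1 False ys))
     - 2 * int (fib_val xs) * int (fib_val ys)" if "length xs = k" "length ys = n" for xs ys
  proof -
    have t: "int (fanT1 True ys) = int (fanT1 False ys) + int (fib (2 * n)) - 2 * int (fib_val ys)"
      using fanT1_diff[of ys] that by simp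
    show ?thesis unfolding r[OF that(2)] t that(1) by (simp add: algebra_simps)
  qed
  then show ?thesis
    by (intro exI[of _ "\<lambda>xs. r xs + int (fib_val xs) * int (fib (2 * n))"]
        exI[of _ "\<lambda>ys. int (fib (2 * k + 1)) * int (fanT0 ys) + int (fib (2 * k)) * int (fanT1 False ys)"]) blast
qed

lemma fib_val_le: "fib_val ds \<le> fib (2 * length ds)"
  by (induction ds) auto

text \<open>The later bits add up to less than the Fibonacci number of the first position, so the
  value determines the first bit.\<close>

lemma fib_val_inj: "length xs = length ys \<Longrightarrow> fib_val xs = fib_val ys \<Longrightarrow> xs = ys"
proof (induction xs ys rule: list_induct2)
  case (Cons x xs y ys)
  have lt: "fib (2 * n) < fib (2 * n + 1)" for n
    by (cases n) (auto simp: fib_neq_0_nat)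
  have "fib_val xs < fib (2 * length xs + 1)" "fib_val ys < fib (2 * length xs + 1)"
    using fib_val_le[of xs] fib_val_le[of ys] lt[of "length xs"] Cons.hyps by simp_all
  then show ?case using Cons by (auto split: if_splits)
qed simp

lemma fib_val_append:
  "length vs = length ws \<Longrightarrow> fib_val (us @ vs) + fib_val ws = fib_val (us @ ws) + fib_val vs"
  by (induction us) auto

text \<open>Once the first \<open>k - m\<close> bits are fixed, the last \<open>m\<close> bits have
  distinct values below \<open>d\<close>, so the residue determines them.\<close>

lemma card_fib_val_mod:
  assumes "m \<le> k" "fib (2 * m) < d"
  shows "card {xs. length xs = k \<and> fib_val xs mod d = \<rho>} \<le> 2 ^ (k - m)"
proof -
  let ?S = "{xs. length xs = k \<and> fib_val xs mod d = \<rho>}"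
  have fin: "finite {xs :: bool list. length xs = j}" for j
    using finite_lists_length_eq[of "UNIV :: bool set" j] by simp
  have "inj_on (take (k - m)) ?S"
  proof (rule inj_onI)
    fix xs ys assume "xs \<in> ?S" "ys \<in> ?S" and t: "take (k - m) xs = take (k - m) ys"
    then have l: "length xs = k" "length ys = k" and e: "fib_val xs mod d = fib_val ys mod d" by auto
    let ?us = "take (k - m) xs" and ?x = "drop (k - m) xs" and ?y = "drop (k - m) ys"
    have lxy: "length ?x = m" "length ?y = m" using l assms(1) by auto
    have "fib_val xs + fib_val ?y = fib_val ys + fib_val ?x"
      using fib_val_append[of ?x ?y ?us] lxy t by (metis append_take_drop_id)
    then have "[fib_val xs + fib_val ?y = fib_val xs + fib_val ?x] (mod d)"
      using e by (metis cong_def mod_add_left_eq)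
    then have "[fib_val ?x = fib_val ?y] (mod d)" by (simp only: cong_add_lcancel_nat cong_sym_eq)
    moreover have "fib_val ?x < d" "fib_val ?y < d"
      using fib_val_le[of ?x] fib_val_le[of ?y] lxy assms(2) by simp_all
    ultimately have "?x = ?y" using lxy by (intro fib_val_inj) (auto simp: cong_def)
    then show "xs = ys" using t by (metis append_take_drop_id)
  qed
  then have "card ?S = card (take (k - m) ` ?S)" by (simp add: card_image)
  also have "\<dots> \<le> card {xs :: bool list. length xs = k - m}"
    by (rule card_mono[OF fin]) auto
  also have "\<dots> = 2 ^ (k - m)" using card_lists_length_eq[of "UNIV :: bool set" "k - m"] by simp
  finally show ?thesis .
qed

section \<open>A Fibonacci number coprime to the modulus\<close>

text \<open>By induction on \<open>n - m\<close>, from the recurrence of Leibniz' harmonic triangle for \<open>1 / (m * (n choose m))\<close>.\<close>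

lemma inverse_times_binomial:
  assumes "1 \<le> m" "m \<le> n"
  shows "\<exists>z::int. real (Lcm {1..n}) / (real m * real (n choose m)) = of_int z"
  using assms
proof (induction "n - m" arbitrary: n m)
  case 0
  then have nm: "n = m" by simp
  have "n dvd Lcm {1..n}" using 0 by (intro dvd_Lcm) auto
  then obtain q where "Lcm {1..n} = n * q" by (rule dvdE)
  then show ?case using 0 nm by (intro exI[of _ "int q"]) simp
next
  case (Suc j)
  then obtain n' where n: "n = Suc n'" "m \<le> n'" by (cases n) auto
  have "Lcm {1..n'} dvd Lcm {1..n}" using n by (intro Lcm_subset) auto
  then obtain q where q: "Lcm {1..n} = Lcm {1..n'} * q" by (rule dvdE)
  obtain z1 where z1: "real (Lcm {1..n'}) / (real m * real (n' choose m)) = of_int z1"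
    using Suc.hyps(1)[of n' m] Suc.hyps(2) Suc.prems n by (auto simp: Suc_diff_le)
  obtain z2 where z2: "real (Lcm {1..n}) / (real (Suc m) * real (n choose Suc m)) = of_int z2"
  proof -
    have "\<exists>z::int. real (Lcm {1..n}) / (real (Suc m) * real (n choose Suc m)) = of_int z"
      by (rule Suc.hyps(1)) (use Suc.hyps(2) n in \<open>auto\<close>)
    then show ?thesis using that by blast
  qed
  have a: "real (n choose Suc m) * real (Suc m) = real n * real (n' choose m)"
    using Suc_times_binomial_eq[of n' m] n by (metis of_nat_mult)
  have b: "real (n choose m) * (real n - real m) = real n * real (n' choose m)"
    using binomial_absorb_comp[of n m] n by (metis diff_Suc_1 le_SucI mult.commute of_nat_diff of_nat_mult)
  have pos: "real (n' choose m) > 0" "real m > 0" "real n > real m" "real n > 0"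
    using n Suc.prems by auto
  have "1 / (real m * real (n choose m)) = 1 / (real m * real (n' choose m)) - 1 / (real (Suc m) * real (n choose Suc m))"
  proof -
    have c: "real (n choose m) = real n * real (n' choose m) / (real n - real m)"
      using b pos by (simp add: field_simps)
    have d: "real (Suc m) * real (n choose Suc m) = real n * real (n' choose m)" using a by (simp add: mult.commute)
    show ?thesis unfolding c d using pos by (simp add: field_simps)
  qed
  then have "real (Lcm {1..n}) / (real m * real (n choose m)) =
      real (Lcm {1..n}) * (1 / (real m * real (n' choose m)) - 1 / (real (Suc m) * real (n choose Suc m)))"
    by (metis mult.right_neutral times_divide_eq_right)
  also have "\<dots> = real q * (real (Lcm {1..n'}) / (real m * real (n' choose m)))
      - real (Lcm {1..n}) / (real (Suc m) * real (n choose Suc m))"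
    unfolding right_diff_distrib by (simp only: q of_nat_mult times_divide_eq_right mult.right_neutral mult.commute)
  also have "\<dots> = of_int (int q * z1 - z2)" unfolding z1 z2 by simp
  finally have "real (Lcm {1..n}) / (real m * real (n choose m)) = of_int (int q * z1 - z2)" .
  then show ?case by blast
qed

lemma binomial_dvd_Lcm:
  assumes "1 \<le> m" "m \<le> n"
  shows "m * (n choose m) dvd Lcm {1..n}"
proof -
  obtain z where z: "real (Lcm {1..n}) / (real m * real (n choose m)) = of_int z"
    using inverse_times_binomial[OF assms] by blast
  have "m * (n choose m) > 0" using assms by simp
  then have "real_of_int (int (Lcm {1..n})) = real_of_int (int (m * (n choose m)) * z)"
    using z by (simp add: field_simps)
  then have "int (Lcm {1..n}) = int (m * (n choose m)) * z" by (simp only: of_int_eq_iff)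
  then have "int (m * (n choose m)) dvd int (Lcm {1..n})" by (rule dvdI)
  then show ?thesis by (simp only: of_nat_dvd_iff)
qed

text \<open>The multiplicity of a prime in a least common multiple is a maximum, so the prime power
  divides one of the arguments.\<close>

lemma prime_power_dvd_Lcm_le:
  assumes "prime (p :: nat)" "p ^ e dvd Lcm {1..n}" "1 \<le> n"
  shows "p ^ e \<le> n"
proof -
  have "finite A \<Longrightarrow> 0 \<notin> A \<Longrightarrow> e \<noteq> 0 \<Longrightarrow> p ^ e dvd Lcm A \<Longrightarrow> \<exists>a\<in>A. p ^ e dvd a" for A :: "nat set"
  proof (induction A rule: finite_induct)
    case empty
    then show ?case using assms(1) by (simp add: prime_nat_iff)
  next
    case (insert a A)
    have nz: "a \<noteq> 0" "Lcm A \<noteq> 0" using insert by (auto simp: Lcm_0_iff)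
    have "e \<le> multiplicity p (lcm a (Lcm A))"
      using insert nz assms(1) by (intro multiplicity_geI) (auto simp: lcm_eq_0_iff)
    also have "\<dots> = max (multiplicity p a) (multiplicity p (Lcm A))"
      using assms(1) nz prime_factorization_lcm[of a "Lcm A"]
      by (metis count_prime_factorization_prime count_union_mset lcm_eq_0_iff)
    finally have "e \<le> multiplicity p a \<or> e \<le> multiplicity p (Lcm A)" by auto
    then show ?case using insert by (auto simp: le_max_iff_disj intro: multiplicity_dvd')
  qed
  from this[of "{1..n}"] assms(2,3) show ?thesis
    by (cases "e = 0") (auto dest: dvd_imp_le)
qed

lemma prod_primes_dvd:
  assumes "finite A" "\<And>p. p \<in> A \<Longrightarrow> prime p" "\<And>p. p \<in> A \<Longrightarrow> p dvd n"
  shows "\<Prod>A dvd (n :: nat)"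
  using assms
proof (induction A rule: finite_induct)
  case (insert p A)
  have "coprime p (\<Prod>A)"
    by (rule prod_coprime_right) (use insert in \<open>auto intro: primes_coprime\<close>)
  then show ?case using insert by (auto intro: divides_mult)
qed simp

text \<open>The argument of Erdos: for \<open>n = 2 * m + 1\<close> the primes above
  \<open>m + 1\<close> divide \<open>n choose m\<close>, which is at most \<open>4 ^ m\<close> as it
  occurs twice in its row; an even \<open>n > 2\<close> adds no prime.\<close>

lemma primorial_le:
  "(\<Prod>p | prime p \<and> p \<le> n. p) \<le> (4 :: nat) ^ n"
proof (induction n rule: less_induct)
  case (less n)
  have "n \<le> 1 \<or> n = 2 \<or> n > 2 \<and> even n \<or> (\<exists>m. n = 2 * m + 1 \<and> m \<ge> 1)" by presburger
  then consider "n \<le> 1" | "n = 2" | "n > 2" "even n" | m where "n = 2 * m + 1" "m \<ge> 1" by blast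
  then show ?case
  proof cases
    case 1
    then have "{p. prime p \<and> p \<le> n} = {}" by (auto simp: prime_nat_iff)
    then show ?thesis by (simp only: prod.empty) simp
  next
    case 2
    have "{p :: nat. prime p \<and> p \<le> 2} = {2}" by (auto simp: prime_ge_2_nat le_antisym)
    then show ?thesis using 2 by simp
  next
    case 3
    have "prime p \<and> p \<le> n \<longleftrightarrow> prime p \<and> p \<le> n - 1" for p
      using 3 prime_odd_nat[of p] by (cases "p = n") auto
    then have "(\<Prod>p | prime p \<and> p \<le> n. p) \<le> 4 ^ (n - 1)" using less.IH[of "n - 1"] 3 by simp
    also have "\<dots> \<le> (4 :: nat) ^ n" by (rule power_increasing) auto
    finally show ?thesis .
  next
    case 4
    let ?A = "{p. prime p \<and> p \<le> m + 1}" and ?B = "{p. prime p \<and> m + 1 < p \<and> p \<le> n}"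
    have split: "{p. prime p \<and> p \<le> n} = ?A \<union> ?B" using 4 by auto
    have "\<Prod>?B dvd (n choose m)"
    proof (rule prod_primes_dvd)
      fix p assume p: "p \<in> ?B"
      then have "p dvd fact n" using prime_dvd_fact_iff[of p n] by auto
      moreover have "fact n = fact m * fact (m + 1) * (n choose m)"
        using binomial_fact_lemma[of m n] 4 by (simp add: algebra_simps)
      moreover have "\<not> p dvd fact m" "\<not> p dvd fact (m + 1)"
        using p prime_dvd_fact_iff[of p] by (auto simp del: fact_Suc)
      ultimately show "p dvd (n choose m)" using p by (auto simp: prime_dvd_mult_iff)
    qed auto
    then have "\<Prod>?B \<le> n choose m" using 4 by (intro dvd_imp_le) auto
    also have "(n choose m) \<le> 4 ^ m"
    proof -
      have "2 * (n choose m) = (n choose m) + (n choose (m + 1))"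
        using binomial_symmetric[of m n] 4 by simp
      also have "\<dots> = (\<Sum>k\<in>{m, m + 1}. n choose k)" by simp
      also have "\<dots> \<le> (\<Sum>k\<le>n. n choose k)" using 4 by (intro sum_mono2) auto
      also have "\<dots> = 2 ^ n" by (rule choose_row_sum)
      also have "\<dots> = 2 * 4 ^ m" using 4 by (simp add: power_mult)
      finally show ?thesis by simp
    qed
    finally have B: "\<Prod>?B \<le> 4 ^ m" .
    have "(\<Prod>p | prime p \<and> p \<le> n. p) = \<Prod>?A * \<Prod>?B"
      unfolding split by (intro prod.union_disjoint) auto
    also have "\<dots> \<le> 4 ^ (m + 1) * 4 ^ m"
      using less.IH[of "m + 1"] 4 B by (intro mult_mono) auto
    also have "\<dots> = (4 :: nat) ^ n" using 4 by (simp flip: power_add)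
    finally show ?thesis .
  qed
qed

text \<open>Every prime power in the factorization is at most \<open>2 * m\<close>. Primes up to
  \<open>w\<close> are bounded one by one, those in the middle range have exponent at most 1 and
  fall under the primorial bound, and those above \<open>a\<close> are counted.\<close>

lemma central_binomial_le:
  assumes "1 \<le> m" "2 * m < (w + 1)\<^sup>2" "w \<le> a" "a \<le> 2 * m"
  shows "(2 * m) choose m \<le> (2 * m) ^ w * 4 ^ a * (2 * m) ^ card {p. prime p \<and> a < p \<and> p \<le> 2 * m}"
proof -
  let ?C = "(2 * m) choose m"
  let ?P = "{p. prime p \<and> p \<le> 2 * m}" and ?P1 = "{p. prime p \<and> p \<le> w}"
    and ?P2 = "{p. prime p \<and> w < p \<and> p \<le> a}" and ?P3 = "{p. prime p \<and> a < p \<and> p \<le> 2 * m}"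
  let ?f = "\<lambda>p. p ^ multiplicity p ?C"
  have C0: "?C \<noteq> 0" by simp
  have dvd_L: "?C dvd Lcm {1..2 * m}" using binomial_dvd_Lcm[of m "2 * m"] assms(1) by (auto intro: dvd_mult_right)
  have le: "?f p \<le> 2 * m" if "prime p" for p
    using that assms(1) dvd_L multiplicity_dvd[of p ?C] by (intro prime_power_dvd_Lcm_le) (auto intro: dvd_trans)
  \<comment> \<open>The square of a prime above \<open>w\<close> exceeds
    \<open>2 * m\<close>.\<close>
  have le1: "?f p \<le> p" if "prime p" "w < p" for p
  proof (rule ccontr)
    assume "\<not> ?f p \<le> p"
    then have "multiplicity p ?C \<ge> 2"
      using that(1) by (metis One_nat_def Suc_1 Suc_leI le_eq_less_or_eq less_one linorder_not_le power_0 power_one_right prime_ge_1_nat)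
    then have "p\<^sup>2 \<le> ?f p" using prime_ge_1_nat[OF that(1)] by (intro power_increasing) auto
    moreover have "(w + 1)\<^sup>2 \<le> p\<^sup>2" using that(2) by (intro power_mono) auto
    ultimately show False using le[OF that(1)] assms(2) by linarith
  qed
  have "prime_factors ?C \<subseteq> ?P"
  proof
    fix p assume p: "p \<in> prime_factors ?C"
    have "fact m * fact (2 * m - m) * ?C = fact (2 * m)" by (rule binomial_fact_lemma) simp
    then have "?C dvd fact (2 * m)" by (metis dvd_triv_right)
    moreover have "p dvd ?C" using p by (simp only: in_prime_factors_iff)
    ultimately have "p dvd fact (2 * m)" by (rule dvd_trans[rotated])
    then show "p \<in> ?P" using p prime_dvd_fact_iff[of p] by (auto simp: in_prime_factors_iff)
  qed
  have fin: "finite ?P" "finite ?P1" "finite ?P2" "finite ?P3" by auto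
  have "?C = (\<Prod>p\<in>prime_factors ?C. ?f p)" using C0 by (intro prime_factorization_nat) simp
  also have "\<dots> = prod ?f ?P"
    using \<open>prime_factors ?C \<subseteq> ?P\<close>
    by (intro prod.mono_neutral_left) (auto simp: in_prime_factors_iff not_dvd_imp_multiplicity_0)
  also have "?P = ?P1 \<union> (?P2 \<union> ?P3)" using assms(3,4) by auto
  also have "prod ?f \<dots> = prod ?f ?P1 * (prod ?f ?P2 * prod ?f ?P3)"
    using assms(3) by (subst prod.union_disjoint; (subst prod.union_disjoint)?; auto)
  also have "\<dots> \<le> (2 * m) ^ w * (4 ^ a * (2 * m) ^ card ?P3)"
  proof (intro mult_mono)
    have "prod ?f ?P1 \<le> (\<Prod>p\<in>?P1. 2 * m)" using le by (intro prod_mono) auto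
    also have "\<dots> = (2 * m) ^ card ?P1" by simp
    also have "card ?P1 \<le> card {1..w}" by (intro card_mono) (auto simp: Suc_le_eq prime_gt_0_nat)
    then have "(2 * m) ^ card ?P1 \<le> (2 * m) ^ w" using assms(1) by (intro power_increasing) auto
    finally show "prod ?f ?P1 \<le> (2 * m) ^ w" .
    have "prod ?f ?P2 \<le> \<Prod>?P2" using le1 by (intro prod_mono) auto
    also have "\<dots> dvd \<Prod>{p. prime p \<and> p \<le> a}" by (intro prod_dvd_prod_subset) auto
    then have "\<Prod>?P2 \<le> \<Prod>{p. prime p \<and> p \<le> a}"
      by (intro dvd_imp_le) (auto intro!: prod_pos simp: prime_gt_0_nat)
    also have "\<dots> \<le> 4 ^ a" by (rule primorial_le)
    finally show "prod ?f ?P2 \<le> 4 ^ a" .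
    have "prod ?f ?P3 \<le> (\<Prod>p\<in>?P3. 2 * m)" using le by (intro prod_mono) auto
    then show "prod ?f ?P3 \<le> (2 * m) ^ card ?P3" by simp
  qed auto
  finally show ?thesis by (simp add: mult.assoc)
qed

section \<open>Pairwise coprime Fibonacci numbers against the prime factors of the modulus\<close>

lemma coprime_fib_double_primes:
  assumes "prime p" "prime q" "p \<noteq> q"
  shows "coprime (fib (2 * p)) (fib (2 * q))"
proof -
  have "gcd (2 * p) (2 * q) = 2" using primes_coprime[OF assms] by (simp add: gcd_mult_distrib_nat[symmetric])
  then have "gcd (fib (2 * p)) (fib (2 * q)) = fib 2" by (simp only: fib_gcd[symmetric])
  then show ?thesis by (simp only: coprime_iff_gcd_eq_1) (simp add: numeral_2_eq_2)
qed

text \<open>Choose a common prime factor of \<open>fib (2 * q)\<close> and \<open>N\<close> for each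
  \<open>q\<close>; coprimality forces different choices.\<close>

lemma distinct_prime_divisors:
  assumes "\<And>q. q \<in> Q \<Longrightarrow> prime q \<and> \<not> coprime (fib (2 * q)) N"
  shows "\<exists>l. inj_on l Q \<and> (\<forall>q\<in>Q. prime (l q) \<and> l q dvd N)"
proof -
  have "\<exists>l. prime l \<and> l dvd fib (2 * q) \<and> l dvd N" if "q \<in> Q" for q
  proof -
    have "gcd (fib (2 * q)) N \<noteq> 1" using assms[OF that] by (auto simp: coprime_iff_gcd_eq_1)
    then show ?thesis using prime_factor_nat[of "gcd (fib (2 * q)) N"] by auto
  qed
  then obtain l where l: "\<And>q. q \<in> Q \<Longrightarrow> prime (l q) \<and> l q dvd fib (2 * q) \<and> l q dvd N" by metis
  have "inj_on l Q"
  proof (rule inj_onI, rule ccontr)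
    fix p q assume *: "p \<in> Q" "q \<in> Q" "l p = l q" "p \<noteq> q"
    then have "coprime (fib (2 * p)) (fib (2 * q))" using assms by (intro coprime_fib_double_primes) auto
    then have "is_unit (l p)" using l[OF *(1)] l[OF *(2)] *(3) by (metis coprime_common_divisor)
    then show False using l[OF *(1)] by (auto simp: not_prime_unit)
  qed
  then show ?thesis using l by blast
qed

text \<open>If the Fibonacci numbers \<open>fib (2 * q)\<close>, which are pairwise coprime, all had a common factor with
  \<open>N\<close>, then \<open>N\<close> would have too many prime factors.\<close>

lemma eventually_coprime_fib:
  "\<exists>k0. \<forall>k\<ge>k0. \<forall>N. 1 \<le> N \<and> N \<le> 2 ^ k \<longrightarrow>
     (\<exists>q. prime q \<and> 2 * k < q \<and> q \<le> 8 * k \<and> coprime (fib (2 * q)) N)"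
proof -
  \<comment> \<open>This contradicts the bound \<open>4 ^ k \<le> (8 * k) ^ (2 * w + 1)\<close>
    reached at the end, where \<open>w\<close> is at most the square root of
    \<open>8 * k\<close>.\<close>
  have "eventually (\<lambda>k. (8 * k) powr (2 * sqrt (8 * k) + 1) < 4 powr k \<and> k \<ge> 4) at_top"
    by (intro eventually_conj) (real_asymp, rule eventually_ge_at_top)
  then have "eventually (\<lambda>k. (8 * real k) powr (2 * sqrt (8 * real k) + 1) < 4 powr real k \<and> real k \<ge> 4) sequentially"
    by (rule eventually_compose_filterlim) (rule filterlim_real_sequentially)
  then obtain k0 where k0: "\<And>k. k \<ge> k0 \<Longrightarrow> (8 * real k) powr (2 * sqrt (8 * real k) + 1) < 4 powr real k \<and> real k \<ge> 4"
    unfolding eventually_sequentially by blast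
  show ?thesis
  proof (rule exI[of _ k0], intro allI impI)
    fix k N :: nat assume "k0 \<le> k" and N: "1 \<le> N \<and> N \<le> 2 ^ k"
    then have big: "(8 * real k) powr (2 * sqrt (8 * real k) + 1) < 4 powr real k" and k4: "k \<ge> 4"
      using k0[of k] by auto
    let ?Q = "{q. prime q \<and> 2 * k < q \<and> q \<le> 2 * (4 * k)}"
    define w where "w = nat \<lfloor>sqrt (8 * real k)\<rfloor>"
    have w: "real w \<le> sqrt (8 * real k)" "sqrt (8 * real k) < real w + 1"
      unfolding w_def by (simp_all add: of_nat_nat floor_less_iff) linarith?
    have "real (8 * k) = (sqrt (8 * real k))\<^sup>2" by simp
    also have "\<dots> < (real w + 1)\<^sup>2" using w(2) by (intro power_strict_mono) auto
    finally have "real (8 * k) < real ((w + 1)\<^sup>2)" by (simp add: add.commute)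
    then have w2: "8 * k < (w + 1)\<^sup>2" by (simp only: of_nat_less_iff)
    have wa: "w \<le> 2 * k"
    proof -
      have "8 * k \<le> (2 * k)\<^sup>2" using k4 by (simp add: power2_eq_square)
      then have "real (8 * k) \<le> real ((2 * k)\<^sup>2)" by (simp only: of_nat_le_iff)
      then have "8 * real k \<le> (2 * real k)\<^sup>2" by (simp only: of_nat_mult of_nat_power of_nat_numeral)
      then have "sqrt (8 * real k) \<le> 2 * real k" by (intro real_le_lsqrt) auto
      then have "real w \<le> real (2 * k)" using w(1) by simp
      then show ?thesis by (simp only: of_nat_le_iff)
    qed
    show "\<exists>q. prime q \<and> 2 * k < q \<and> q \<le> 8 * k \<and> coprime (fib (2 * q)) N"
    proof (rule ccontr)
      assume neg: "\<not> ?thesis"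
      then obtain l where inj: "inj_on l ?Q" and l: "\<And>q. q \<in> ?Q \<Longrightarrow> prime (l q) \<and> l q dvd N"
        using distinct_prime_divisors[of ?Q N] by auto
      have card: "card (l ` ?Q) = card ?Q" using inj by (rule card_image)
      let ?s = "card ?Q" and ?L = "l ` ?Q"
      let ?L' = "{p \<in> ?L. w < p}"
      have fin: "finite ?L" by auto
      have "?s \<le> card (?L' \<union> {1..w})"
        unfolding card[symmetric] using l by (intro card_mono) (auto simp: Suc_le_eq prime_gt_0_nat not_less)
      also have "\<dots> \<le> card ?L' + w" using card_Un_le[of ?L' "{1..w}"] by simp
      finally have s: "?s \<le> card ?L' + w" .
      \<comment> \<open>The large chosen primes have squares of at least \<open>8 * k\<close> and a
        product of at most \<open>2 ^ k\<close>, so \<open>8 * k\<close> to their number is at most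
        \<open>4 ^ k\<close>. At most \<open>w\<close> of the chosen primes are small.\<close>
      have "(w + 1) ^ card ?L' = (\<Prod>p\<in>?L'. w + 1)" by simp
      also have "\<dots> \<le> \<Prod>?L'" by (intro prod_mono) auto
      also have "\<dots> \<le> N"
        using N l fin by (intro dvd_imp_le prod_primes_dvd) auto
      finally have "(w + 1) ^ card ?L' \<le> 2 ^ k" using N by linarith
      then have "((w + 1) ^ card ?L')\<^sup>2 \<le> (2 ^ k)\<^sup>2" by (intro power_mono) auto
      moreover have "((x :: nat) ^ a)\<^sup>2 = (x\<^sup>2) ^ a" for x a by (metis power_mult mult.commute)
      ultimately have "((w + 1)\<^sup>2) ^ card ?L' \<le> 4 ^ k" by simp
      moreover have "(8 * k) ^ card ?L' \<le> ((w + 1)\<^sup>2) ^ card ?L'" using w2 by (intro power_mono) auto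
      ultimately have L': "(8 * k) ^ card ?L' \<le> 4 ^ k" by linarith
      have "(8 * k) ^ ?s \<le> (8 * k) ^ (card ?L' + w)" using s k4 by (intro power_increasing) auto
      also have "\<dots> \<le> 4 ^ k * (8 * k) ^ w" using L' by (simp add: power_add)
      finally have S: "(8 * k) ^ ?s \<le> 4 ^ k * (8 * k) ^ w" .
      \<comment> \<open>The parameters \<open>m = 4 * k\<close> and \<open>a = 2 * k\<close> leave a
        surplus of \<open>4 ^ k\<close>: the coefficient is about \<open>4 ^ (4 * k)\<close>, while
        the two exponential factors give only \<open>4 ^ (3 * k)\<close>.\<close>
      have "(2 * (4 * k)) choose (4 * k) \<le> (8 * k) ^ w * 4 ^ (2 * k) * (8 * k) ^ ?s"
        using central_binomial_le[of "4 * k" w "2 * k"] k4 w2 wa by simp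
      also have "\<dots> \<le> (8 * k) ^ w * 4 ^ (2 * k) * (4 ^ k * (8 * k) ^ w)" using S by (intro mult_left_mono) auto
      also have "\<dots> = (8 * k) ^ (2 * w) * 4 ^ (3 * k)"
      proof -
        have "x ^ (2 * w) = x ^ w * x ^ w" "x ^ (3 * k) = x ^ (2 * k) * x ^ k" for x :: nat
          by (simp add: mult_2 power_add, simp flip: power_add)
        then show ?thesis by (simp only: mult_ac)
      qed
      finally have "real ((2 * (4 * k)) choose (4 * k)) \<le> real ((8 * k) ^ (2 * w) * 4 ^ (3 * k))" by (simp only: of_nat_le_iff)
      moreover have "4 ^ (4 * k) / (2 * real (4 * k)) \<le> real ((2 * (4 * k)) choose (4 * k))"
        using k4 by (intro central_binomial_lower_bound) auto
      ultimately have "4 ^ (4 * k) / (8 * real k) \<le> (8 * real k) ^ (2 * w) * 4 ^ (3 * k)" by simp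
      then have "4 ^ (4 * k) \<le> (8 * real k) ^ (2 * w + 1) * 4 ^ (3 * k)"
        using k4 by (simp add: divide_simps mult_ac)
      moreover have "(4 :: real) ^ (4 * k) = 4 ^ k * 4 ^ (3 * k)" by (simp flip: power_add)
      ultimately have "4 ^ k \<le> (8 * real k) ^ (2 * w + 1)" by simp
      also have "\<dots> = (8 * real k) powr real (2 * w + 1)" using k4 by (subst powr_realpow) auto
      also have "\<dots> \<le> (8 * real k) powr (2 * sqrt (8 * real k) + 1)" using w(1) k4 by (intro powr_mono) auto
      also have "\<dots> < 4 powr real k" by (rule big)
      also have "\<dots> = 4 ^ k" by (simp add: powr_realpow)
      finally show False by simp
    qed
  qed
qed

text \<open>For the finitely many small moduli: infinitely many primes \<open>q\<close> would
  require infinitely many divisors of \<open>N\<close>.\<close>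

lemma ex_coprime_fib:
  assumes "1 \<le> N"
  shows "\<exists>q. prime q \<and> k < q \<and> coprime (fib (2 * q)) N"
proof (rule ccontr)
  assume "\<not> ?thesis"
  then obtain l where l: "inj_on l {q. prime q \<and> k < q}" "\<forall>q\<in>{q. prime q \<and> k < q}. prime (l q) \<and> l q dvd N"
    using distinct_prime_divisors[of "{q. prime q \<and> k < q}" N] by auto
  have "l ` {q. prime q \<and> k < q} \<subseteq> {..N}" 
    by (intro image_subsetI) (use l(2) assms in \<open>auto intro!: dvd_imp_le\<close>)
  then have "finite {q :: nat. prime q \<and> k < q}" using l(1) by (meson finite_atMost finite_imageD finite_subset)
  then have "finite ({q :: nat. prime q \<and> k < q} \<union> {..k})" by simp
  then have "finite {q :: nat. prime q}" by (rule rev_finite_subset) auto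
  then show False using primes_infinite by simp
qed

section \<open>Exponential sums\<close>

definition unity :: "nat \<Rightarrow> int \<Rightarrow> complex" where
  "unity N n = cis (2 * pi * real_of_int n / real N)"

lemma unity_add: "unity N (m + n) = unity N m * unity N n"
  by (simp add: unity_def cis_mult add_divide_distrib distrib_left)

lemma unity_0 [simp]: "unity N 0 = 1"
  by (simp add: unity_def)

lemma norm_unity [simp]: "norm (unity N n) = 1"
  by (simp add: unity_def)

lemma cnj_unity: "cnj (unity N n) = unity N (- n)"
  by (simp add: unity_def cis_cnj)

lemma unity_power: "unity N n ^ j = unity N (int j * n)"
  by (simp add: unity_def Complex.DeMoivre mult_ac)

lemma unity_eq_1_iff:
  assumes "N > 0"
  shows "unity N n = 1 \<longleftrightarrow> int N dvd n"
proof
  assume "unity N n = 1"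
  then have "cos (2 * pi * real_of_int n / real N) = 1"
    by (metis unity_def cis.sel(1) one_complex.sel(1))
  then obtain j :: int where "2 * pi * real_of_int n / real N = of_int j * 2 * pi"
    using cos_one_2pi_int by blast
  then have "real_of_int n = real_of_int (j * int N)"
    using assms by (simp add: field_simps)
  then show "int N dvd n" by (simp only: of_int_eq_iff) simp
next
  assume "int N dvd n"
  then obtain j where "n = int N * j" by (rule dvdE)
  then have "2 * pi * real_of_int n / real N = 2 * pi * real_of_int j" using assms by simp
  then show "unity N n = 1" unfolding unity_def by (metis Ints_of_int cis_multiple_2pi)
qed

lemma unity_cong:
  assumes "N > 0" "int N dvd m - n"
  shows "unity N m = unity N n"
  using unity_add[of N "m - n" n] unity_eq_1_iff[OF assms(1), of "m - n"] assms(2) by simp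

text \<open>The hypothesis makes \<open>unity N n\<close> a \<open>d\<close>-th root of unity, so
  \<open>d\<close> terms suffice for cancellation even if \<open>d < N\<close>.\<close>

lemma sum_unity:
  assumes "N > 0" "int N dvd int d * n"
  shows "(\<Sum>j<d. unity N (int j * n)) = (if int N dvd n then of_nat d else 0)"
proof (cases "int N dvd n")
  case True
  then have "unity N (int j * n) = 1" for j using assms(1) by (subst unity_eq_1_iff) auto
  then show ?thesis using True by simp
next
  case False
  then have "unity N n \<noteq> 1" using unity_eq_1_iff[OF assms(1)] by simp
  moreover have "unity N n ^ d = 1" using unity_eq_1_iff[OF assms(1)] assms(2) by (simp add: unity_power)
  ultimately have "(\<Sum>j<d. unity N n ^ j) = 0" by (subst geometric_sum) auto
  then show ?thesis using False by (simp add: unity_power)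
qed

text \<open>The Cauchy-Schwarz inequality removes the unknown function \<open>g\<close>, completing the sum over
  residues removes \<open>h\<close>.\<close>

lemma bilinear_sum_bound:
  fixes X :: "'a set" and Y :: "'b set" and g :: "'a \<Rightarrow> int" and h :: "'b \<Rightarrow> int"
    and v :: "'a \<Rightarrow> nat" and w :: "'b \<Rightarrow> nat"
  assumes N: "N > 0" and fin: "finite X" "finite Y" and d: "d = N div gcd t N" "d > 0"
    and mX: "\<And>\<rho>. card {x \<in> X. v x mod d = \<rho>} \<le> mX" and mY: "\<And>\<rho>. card {y \<in> Y. w y mod d = \<rho>} \<le> mY"
  shows "(norm (\<Sum>x\<in>X. \<Sum>y\<in>Y. unity N (g x + h y - int t * int (v x) * int (w y))))\<^sup>2
    \<le> real (d * card X * mX * card Y * mY)"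
proof -
  define Z where "Z \<rho> = (\<Sum>y\<in>Y. unity N (h y - int t * int \<rho> * int (w y)))" for \<rho> :: nat
  have dt: "int N dvd int d * int t"
  proof -
    have "d * t = N * (t div gcd t N)" unfolding d(1)
      by (metis div_mult_swap dvd_div_mult gcd_dvd1 gcd_dvd2 mult.commute)
    then show ?thesis by (metis dvd_triv_left of_nat_mult)
  qed
  \<comment> \<open>Dividing out \<open>gcd t N\<close> leaves a factor that is invertible modulo
    \<open>d\<close>.\<close>
  have td: "[a = b] (mod d)" if "int N dvd int t * (int b - int a)" for a b :: nat
  proof -
    have "int d * int (gcd t N) dvd int t * (int b - int a)"
      using that d(1) by (metis dvd_div_mult_self gcd_dvd2 of_nat_mult)
    moreover have "int t = int (t div gcd t N) * int (gcd t N)" by (metis dvd_div_mult_self gcd_dvd1 of_nat_mult)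
    ultimately have "int (gcd t N) * int d dvd int (gcd t N) * (int (t div gcd t N) * (int b - int a))"
      by (metis mult.assoc mult.commute)
    then have "int d dvd int (t div gcd t N) * (int b - int a)"
      using N by (simp only: dvd_mult_cancel_left) simp
    moreover have "coprime d (t div gcd t N)" unfolding d(1)
      using N by (metis div_gcd_coprime coprime_commute not_gr_zero)
    ultimately have "int d dvd int b - int a"
      by (metis coprime_dvd_mult_right_iff coprime_int_iff)
    then have "[int b = int a] (mod int d)" by (simp add: cong_iff_dvd_diff)
    then show ?thesis by (simp add: cong_int_iff cong_sym_eq)
  qed
  have Zmod: "Z \<rho> = Z (\<rho> mod d)" for \<rho>
    unfolding Z_def
  proof (intro sum.cong refl unity_cong[OF N])
    fix y
    have "int \<rho> - int (\<rho> mod d) = int d * int (\<rho> div d)"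
      by (metis add_diff_cancel_right' mult_div_mod_eq of_nat_add of_nat_mult)
    then have "h y - int t * int \<rho> * int (w y) - (h y - int t * int (\<rho> mod d) * int (w y))
        = - (int d * int t * (int (\<rho> div d) * int (w y)))" by (simp add: algebra_simps)
    then show "int N dvd h y - int t * int \<rho> * int (w y) - (h y - int t * int (\<rho> mod d) * int (w y))"
      using dt by simp
  qed
  \<comment> \<open>Orthogonality over the residues modulo \<open>d\<close> keeps only pairs with
    \<open>w y\<close> and \<open>w z\<close> congruent; on these the phases of \<open>h\<close>
    have norm 1.\<close>
  have "(\<Sum>\<rho><d. Z \<rho> * cnj (Z \<rho>)) =
      (\<Sum>\<rho><d. \<Sum>y\<in>Y. \<Sum>z\<in>Y. unity N (h y - h z) * unity N (int \<rho> * (int t * (int (w z) - int (w y)))))"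
    unfolding Z_def cnj_sum sum_product cnj_unity
    by (intro sum.cong refl) (simp flip: unity_add add: algebra_simps)
  also have "\<dots> = (\<Sum>y\<in>Y. \<Sum>z\<in>Y. \<Sum>\<rho><d. unity N (h y - h z) * unity N (int \<rho> * (int t * (int (w z) - int (w y)))))"
    by (subst sum.swap, intro sum.cong refl, subst sum.swap) simp
  also have "\<dots> = (\<Sum>y\<in>Y. \<Sum>z\<in>Y. unity N (h y - h z) *
      (if int N dvd int t * (int (w z) - int (w y)) then of_nat d else 0))"
    unfolding sum_distrib_left[symmetric]
    by (intro sum.cong refl arg_cong2[of _ _ _ _ "(*)"] sum_unity[OF N]) (use dt in \<open>simp flip: mult.assoc\<close>)
  also have "norm \<dots> \<le> (\<Sum>y\<in>Y. \<Sum>z\<in>Y. if w z mod d = w y mod d then real d else 0)"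
  proof (intro sum_norm_le)
    fix y z
    show "norm (unity N (h y - h z) * (if int N dvd int t * (int (w z) - int (w y)) then of_nat d else 0))
        \<le> (if w z mod d = w y mod d then real d else 0)"
      using td[of "w z" "w y"] by (auto simp: norm_mult cong_def)
  qed
  also have "\<dots> = (\<Sum>y\<in>Y. real d * real (card {z \<in> Y. w z mod d = w y mod d}))"
    using fin by (intro sum.cong refl) (simp add: sum.If_cases Int_def)
  also have "\<dots> \<le> (\<Sum>y\<in>Y. real d * real mY)"
    using mY by (intro sum_mono mult_left_mono) auto
  finally have "norm (\<Sum>\<rho><d. Z \<rho> * cnj (Z \<rho>)) \<le> real (d * card Y * mY)" by (simp add: mult_ac)
  moreover have "(\<Sum>\<rho><d. Z \<rho> * cnj (Z \<rho>)) = of_real (\<Sum>\<rho><d. (norm (Z \<rho>))\<^sup>2)"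
    by (simp add: complex_norm_square del: of_real_power)
  ultimately have Z2: "(\<Sum>\<rho><d. (norm (Z \<rho>))\<^sup>2) \<le> real (d * card Y * mY)"
    by (simp only: norm_of_real)
  \<comment> \<open>Each residue is taken by at most \<open>mX\<close> elements of \<open>X\<close>,
    so the complete sum bounds this one up to that factor.\<close>
  have "(\<Sum>x\<in>X. (norm (Z (v x)))\<^sup>2) = (\<Sum>x\<in>X. (norm (Z (v x mod d)))\<^sup>2)"
    by (intro sum.cong refl) (use Zmod in metis)
  also have "\<dots> = (\<Sum>\<rho><d. \<Sum>x\<in>{x \<in> X. v x mod d = \<rho>}. (norm (Z (v x mod d)))\<^sup>2)"
    using fin(1) d(2) by (intro sum.group[symmetric]) auto
  also have "\<dots> = (\<Sum>\<rho><d. real (card {x \<in> X. v x mod d = \<rho>}) * (norm (Z \<rho>))\<^sup>2)"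
    by (intro sum.cong refl) simp
  also have "\<dots> \<le> (\<Sum>\<rho><d. real mX * (norm (Z \<rho>))\<^sup>2)"
    using mX by (intro sum_mono mult_right_mono) auto
  also have "\<dots> \<le> real mX * real (d * card Y * mY)"
    unfolding sum_distrib_left[symmetric] by (intro mult_left_mono Z2) auto
  finally have ZX: "(\<Sum>x\<in>X. (norm (Z (v x)))\<^sup>2) \<le> real mX * real (d * card Y * mY)" .
  have "norm (\<Sum>x\<in>X. \<Sum>y\<in>Y. unity N (g x + h y - int t * int (v x) * int (w y))) \<le> (\<Sum>x\<in>X. norm (Z (v x)))"
  proof (intro sum_norm_le)
    fix x
    have "(\<Sum>y\<in>Y. unity N (g x + h y - int t * int (v x) * int (w y))) = unity N (g x) * Z (v x)"
      unfolding Z_def sum_distrib_left by (simp flip: unity_add add: algebra_simps)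
    then show "norm (\<Sum>y\<in>Y. unity N (g x + h y - int t * int (v x) * int (w y))) \<le> norm (Z (v x))"
      by (simp add: norm_mult)
  qed
  then have "(norm (\<Sum>x\<in>X. \<Sum>y\<in>Y. unity N (g x + h y - int t * int (v x) * int (w y))))\<^sup>2 \<le> (\<Sum>x\<in>X. norm (Z (v x)))\<^sup>2"
    by (intro power_mono) auto
  also have "\<dots> \<le> (\<Sum>x\<in>X. (norm (Z (v x)))\<^sup>2) * real (card X)"
    using sum_squared_le_sum_of_squares[of "\<lambda>x. norm (Z (v x))" X] by simp
  also have "\<dots> \<le> real mX * real (d * card Y * mY) * real (card X)"
    by (intro mult_right_mono ZX) auto
  finally show ?thesis by (simp add: mult_ac)
qed

text \<open>The left-hand side is \<open>N\<close> times the number of representations of \<open>v\<close>, expanded into characters.\<close>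

lemma representation_sum_eq_0:
  fixes T :: "'a \<Rightarrow> int"
  assumes N: "N > 0" and A: "finite A"
    and no: "\<And>as \<epsilon>. length as = r \<Longrightarrow> set as \<subseteq> A \<Longrightarrow> \<not> int N dvd sum_list (map T as) + of_bool \<epsilon> * H - v"
  shows "(\<Sum>t<N. (1 + unity N (int t * H)) * (\<Sum>a\<in>A. unity N (int t * T a)) ^ r * unity N (- (int t * v))) = 0"
  using no
proof (induction r arbitrary: v)
  case 0
  have *: "(\<Sum>t<N. unity N (int t * n)) = 0" if "\<not> int N dvd n" for n
    using sum_unity[OF N, of N n] that by simp
  have "\<not> int N dvd - v" "\<not> int N dvd H - v" using 0[of "[]" False] 0[of "[]" True] by auto
  from this[THEN *] show ?case
    by (simp add: distrib_right sum.distrib right_diff_distrib flip: unity_add)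
next
  case (Suc r)
  let ?S = "\<lambda>t. \<Sum>a\<in>A. unity N (int t * T a)" and ?E = "\<lambda>t. 1 + unity N (int t * H)"
  \<comment> \<open>Expanding one factor of the power shifts the target from \<open>v\<close> to
    \<open>v - T a\<close>.\<close>
  have "(\<Sum>t<N. ?E t * ?S t ^ Suc r * unity N (- (int t * v))) =
      (\<Sum>t<N. \<Sum>a\<in>A. ?E t * ?S t ^ r * unity N (- (int t * (v - T a))))"
  proof (intro sum.cong refl)
    fix t
    have "?S t * unity N (- (int t * v)) = (\<Sum>a\<in>A. unity N (- (int t * (v - T a))))"
      unfolding sum_distrib_right by (intro sum.cong refl) (simp flip: unity_add add: algebra_simps)
    then have "?E t * ?S t ^ r * (?S t * unity N (- (int t * v)))
        = (\<Sum>a\<in>A. ?E t * ?S t ^ r * unity N (- (int t * (v - T a))))" by (simp only: sum_distrib_left)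
    then show "?E t * ?S t ^ Suc r * unity N (- (int t * v))
        = (\<Sum>a\<in>A. ?E t * ?S t ^ r * unity N (- (int t * (v - T a))))" by (simp only: power_Suc2 mult.assoc)
  qed
  also have "\<dots> = (\<Sum>a\<in>A. \<Sum>t<N. ?E t * ?S t ^ r * unity N (- (int t * (v - T a))))" by (rule sum.swap)
  also have "\<dots> = (\<Sum>a\<in>A. 0)"
  proof (intro sum.cong refl Suc.IH)
    fix a as \<epsilon> assume "a \<in> A" "length as = r" "set as \<subseteq> A"
    then show "\<not> int N dvd sum_list (map T as) + of_bool \<epsilon> * H - (v - T a)"
      using Suc.prems[of "a # as" \<epsilon>] by (simp add: algebra_simps)
  qed
  finally show ?case by simp
qed

section \<open>Estimates for the sum over all characters\<close>

lemma power_le_fib: "2 ^ k \<le> fib (2 * k + 2)"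
proof (induction k)
  case (Suc k)
  have "fib (2 * k + 2) \<le> fib (2 * k + 3)" by (intro fib_mono) auto
  then show ?case using Suc by (simp add: numeral_eq_Suc)
qed (simp add: numeral_2_eq_2)

text \<open>The exponent 23 is 20 from the bilinear bound plus 3 for the decay wanted in
  \<open>d\<close>. Raising \<open>m\<close> by one at most triples the Fibonacci number, and
  \<open>3 ^ 23 \<le> 4 ^ 20\<close>.\<close>

lemma fib_power_bound:
  assumes "m \<ge> 1"
  shows "4 * fib (2 * m + 2) ^ 23 \<le> 4 ^ (20 * m)"
  using assms
proof (induction m rule: dec_induct)
  case base
  have "fib 4 = 3" by (simp add: numeral_eq_Suc)
  then show ?case by simp
next
  case (step m)
  have "fib (2 * m + 4) \<le> 3 * fib (2 * m + 2)" by (simp add: numeral_eq_Suc)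
  then have "fib (2 * m + 4) ^ 23 \<le> (3 * fib (2 * m + 2)) ^ 23" by (rule power_mono) simp
  also have "\<dots> = 3 ^ 23 * fib (2 * m + 2) ^ 23" by (rule power_mult_distrib)
  finally have "4 * fib (2 * m + 4) ^ 23 \<le> 3 ^ 23 * (4 * fib (2 * m + 2) ^ 23)" by linarith
  also have "\<dots> \<le> 4 ^ 20 * 4 ^ (20 * m)" by (intro mult_mono step.IH) simp_all
  also have "\<dots> = 4 ^ (20 * Suc m)" by (simp only: power_add[symmetric]) (simp add: algebra_simps)
  finally have "4 * fib (2 * m + 4) ^ 23 \<le> 4 ^ (20 * Suc m)" .
  moreover have "2 * Suc m + 2 = 2 * m + 4" by simp
  ultimately show ?case by (simp only:)
qed

text \<open>Take the largest \<open>m\<close> for which the residue count modulo \<open>d\<close>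
  applies; then \<open>d \<le> fib (2 * m + 2)\<close>.\<close>

lemma fib_bracket:
  assumes "2 \<le> d" "d \<le> 2 ^ k"
  obtains m where "m \<le> k" "fib (2 * m) < d" "4 * d ^ 23 \<le> 4 ^ (20 * m)"
proof -
  have ex: "d \<le> fib (2 * k + 2)" using assms(2) power_le_fib[of k] by linarith
  define m where "m = (LEAST m. d \<le> fib (2 * m + 2))"
  have m: "d \<le> fib (2 * m + 2)" "m \<le> k"
    unfolding m_def using ex by (auto intro: LeastI Least_le)
  have "fib 2 = 1" by (simp add: numeral_2_eq_2)
  then have "m \<noteq> 0" using m(1) assms(1) by (intro notI) simp
  then obtain j where j: "m = Suc j" by (cases m) auto
  then have "\<not> d \<le> fib (2 * j + 2)" unfolding m_def by (metis lessI not_less_Least)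
  then have "fib (2 * m) < d" using j by simp
  moreover have "4 * d ^ 23 \<le> 4 ^ (20 * m)"
  proof -
    have "d ^ 23 \<le> fib (2 * m + 2) ^ 23" using m(1) by (rule power_mono) simp
    then show ?thesis using fib_power_bound[of m] j by linarith
  qed
  ultimately show thesis using that m(2) by blast
qed

lemma sum_inverse_squares_le: "(\<Sum>d = 2..n. 1 / (real d)\<^sup>2) \<le> 1"
proof -
  have "(\<Sum>d = 2..n. 1 / (real d)\<^sup>2) \<le> 1 - 1 / real n" if "n \<ge> 1"
    using that
  proof (induction n rule: dec_induct)
    case (step n)
    have "1 / (real (Suc n))\<^sup>2 \<le> 1 / (real n * real (Suc n))"
      unfolding power2_eq_square using step(1) by (intro divide_left_mono mult_right_mono mult_pos_pos) auto
    also have "\<dots> = 1 / real n - 1 / real (Suc n)" using step(1) by (simp add: field_simps)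
    finally have "1 / (real (Suc n))\<^sup>2 \<le> 1 / real n - 1 / real (Suc n)" .
    then show ?case using step by simp
  qed simp
  then show ?thesis by (cases "n \<ge> 1") (auto intro: order_trans)
qed

text \<open>On this level \<open>2 * t\<close> is a multiple of \<open>N div d\<close> below
  \<open>2 * N\<close>.\<close>

lemma card_gcd_level:
  assumes "N > 0" "d > 0"
  shows "card {t \<in> {1..<N}. N div gcd (2 * t) N = d} \<le> 2 * d"
proof -
  let ?T = "{t \<in> {1..<N}. N div gcd (2 * t) N = d}" and ?g = "N div d"
  have g: "?g dvd 2 * t" "?g > 0" "?g * d = N" if "t \<in> ?T" for t
  proof -
    have "N div gcd (2 * t) N = d" using that by blast
    then have e: "d * gcd (2 * t) N = N" by (metis dvd_div_mult_self gcd_dvd2)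
    then have "?g = gcd (2 * t) N" using assms(2) by (metis nonzero_mult_div_cancel_left not_gr_zero)
    moreover have "gcd (2 * t) N * d = N" "gcd (2 * t) N > 0" using e assms(1) by (simp_all add: mult.commute)
    ultimately show "?g dvd 2 * t" "?g > 0" "?g * d = N" by (simp_all only: gcd_dvd1)
  qed
  have "inj_on (\<lambda>t. 2 * t div ?g) ?T"
  proof (rule inj_onI)
    fix s t assume "s \<in> ?T" "t \<in> ?T" "2 * s div ?g = 2 * t div ?g"
    then have "2 * s = 2 * t" using g(1)[of s] g(1)[of t] by (metis dvd_div_mult_self)
    then show "s = t" by simp
  qed
  moreover have "(\<lambda>t. 2 * t div ?g) ` ?T \<subseteq> {..<2 * d}"
  proof (intro image_subsetI)
    fix t assume t: "t \<in> ?T"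
    then have "2 * t < 2 * d * ?g" using g(3)[OF t] by (simp add: mult.commute mult.left_commute)
    then show "2 * t div ?g \<in> {..<2 * d}" by (simp add: less_mult_imp_div_less)
  qed
  ultimately have "card ?T \<le> card {..<2 * d}" by (intro card_inj_on_le) auto
  then show ?thesis by simp
qed

abbreviation bool_lists :: "nat \<Rightarrow> bool list set" where
  "bool_lists n \<equiv> {xs. length xs = n}"

lemma finite_bool_lists: "finite (bool_lists n)" "card (bool_lists n) = 2 ^ n"
  using finite_lists_length_eq[of "UNIV :: bool set" n] card_lists_length_eq[of "UNIV :: bool set" n]
  by simp_all

text \<open>The bilinear bound saves a factor \<open>d / 4 ^ m\<close> on the squared sum, and its
  twentieth power gives the fortieth power of the sum. Cubic decay is chosen because up to
  \<open>2 * d\<close> characters share the level \<open>d\<close>.\<close>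

lemma fib_val_sum_bound:
  fixes g h :: "bool list \<Rightarrow> int"
  assumes N: "N > 0" "N \<le> 2 ^ k" and kx: "k \<le> kx" "k \<le> ky" and d: "d = N div gcd (2 * t) N" "2 \<le> d"
    and T: "\<And>xs ys. length xs = kx \<Longrightarrow> length ys = ky \<Longrightarrow>
      T (xs, ys) = g xs + h ys - 2 * int (fib_val xs) * int (fib_val ys)"
  shows "norm (\<Sum>a\<in>bool_lists kx \<times> bool_lists ky. unity N (int t * T a)) ^ 40
    \<le> (2 ^ kx * 2 ^ ky) ^ 40 / (4 * real d ^ 3)"
proof -
  have "d \<le> 2 ^ k" using d N(2) by (metis div_le_dividend order_trans)
  then obtain m where m: "m \<le> k" "fib (2 * m) < d" "4 * d ^ 23 \<le> 4 ^ (20 * m)"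
    using fib_bracket d(2) by metis
  let ?S = "\<Sum>a\<in>bool_lists kx \<times> bool_lists ky. unity N (int t * T a)"
  let ?A = "2 ^ kx * 2 ^ ky :: real"
  have "?S = (\<Sum>xs\<in>bool_lists kx. \<Sum>ys\<in>bool_lists ky.
      unity N (int t * g xs + int t * h ys - int (2 * t) * int (fib_val xs) * int (fib_val ys)))"
    unfolding sum.cartesian_product
    by (intro sum.cong refl) (auto simp: T algebra_simps)
  also have "(norm \<dots>)\<^sup>2 \<le> real (d * card (bool_lists kx) * 2 ^ (kx - m) * card (bool_lists ky) * 2 ^ (ky - m))"
    using m kx d(2) card_fib_val_mod[of m kx d] card_fib_val_mod[of m ky d]
    by (intro bilinear_sum_bound[OF N(1) finite_bool_lists(1) finite_bool_lists(1) d(1)]) auto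
  also have "\<dots> = ?A\<^sup>2 * (real d / 4 ^ m)"
  proof -
    have "(2 :: real) ^ (kx - m) = 2 ^ kx / 2 ^ m" "(2 :: real) ^ (ky - m) = 2 ^ ky / 2 ^ m"
      using m(1) kx by (simp_all add: power_diff)
    moreover have "(4 :: real) ^ m = 2 ^ m * 2 ^ m" by (simp flip: power_mult_distrib)
    ultimately show ?thesis by (simp add: finite_bool_lists power2_eq_square)
  qed
  finally have "((norm ?S)\<^sup>2) ^ 20 \<le> (?A\<^sup>2 * (real d / 4 ^ m)) ^ 20" by (rule power_mono) simp
  then have "norm ?S ^ 40 \<le> ?A ^ 40 * (real d ^ 20 / 4 ^ (20 * m))"
    by (simp only: power_mult[symmetric] power_mult_distrib power_divide) (simp add: mult.commute)
  also have "\<dots> \<le> ?A ^ 40 * (1 / (4 * real d ^ 3))"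
  proof (intro mult_left_mono)
    have "real (4 * d ^ 23) \<le> real (4 ^ (20 * m))" using m(3) by (simp only: of_nat_le_iff)
    then have "real d ^ 20 * (4 * real d ^ 3) \<le> 4 ^ (20 * m)" by (simp add: mult.left_commute flip: power_add)
    then show "real d ^ 20 / 4 ^ (20 * m) \<le> 1 / (4 * real d ^ 3)" using d(2) by (simp add: field_simps)
  qed simp
  finally show ?thesis by simp
qed

text \<open>The only possibility is \<open>2 * t = N\<close>. Then \<open>H\<close> is odd, the
  character takes the value -1, and the optional hub edge cancels it.\<close>

lemma half_modulus_character:
  assumes "N > 0" "N div gcd (2 * t) N \<le> 1" "0 < t" "t < N" "coprime H N"
  shows "1 + unity N (int t * int H) = 0"
proof -
  have "gcd (2 * t) N = N"
  proof -
    have "N = N div gcd (2 * t) N * gcd (2 * t) N" by simp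
    then have "N \<le> 1 * gcd (2 * t) N" using assms(2) by (metis mult_le_mono1)
    then show ?thesis using assms(1) by (metis gcd_le2_nat le_antisym mult_1 not_gr_zero)
  qed
  then have "N dvd 2 * t" by (metis gcd_dvd1)
  then obtain j where j: "2 * t = N * j" by (rule dvdE)
  then have "N * j \<noteq> 0" "N * j < N * 2" using assms(3,4) by linarith+
  then have "j \<noteq> 0" "j < 2" by simp_all
  then have t: "2 * t = N" using j by simp
  let ?z = "unity N (int t * int H)"
  have "odd H" using assms(5) t by (metis coprime_common_divisor dvd_triv_left odd_one)
  have "\<not> int N dvd int t * int H"
  proof
    assume "int N dvd int t * int H"
    then have "2 * t dvd t * H" using t by (simp flip: of_nat_mult)
    then show False using assms(3) \<open>odd H\<close> by (simp add: mult.commute)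
  qed
  then have "?z \<noteq> 1" using unity_eq_1_iff[OF assms(1)] by simp
  moreover have "?z * ?z = 1"
  proof -
    have "int t * int H + int t * int H = int N * int H" using t by (simp flip: t)
    then have "unity N (int t * int H + int t * int H) = 1"
      using unity_eq_1_iff[OF assms(1), of "int N * int H"] by (simp only: dvd_triv_left)
    then show ?thesis by (simp only: unity_add)
  qed
  ultimately have "?z = - 1" by (metis square_eq_1_iff)
  then show ?thesis by simp
qed

text \<open>Were \<open>v\<close> not represented, the character sum would vanish. But
  \<open>t = 0\<close> contributes \<open>2 * ?A ^ 40\<close>, and all other characters together at
  most \<open>?A ^ 40\<close>.\<close>

lemma residue_represented:
  fixes g h :: "bool list \<Rightarrow> int"
  assumes N: "N > 0" "N \<le> 2 ^ k" and kx: "k \<le> kx" "k \<le> ky" and H: "coprime H N"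
    and T: "\<And>xs ys. length xs = kx \<Longrightarrow> length ys = ky \<Longrightarrow>
      T (xs, ys) = g xs + h ys - 2 * int (fib_val xs) * int (fib_val ys)"
  shows "\<exists>as \<epsilon>. length as = 40 \<and> set as \<subseteq> bool_lists kx \<times> bool_lists ky \<and>
      int N dvd sum_list (map T as) + of_bool \<epsilon> * int H - v"
proof (rule ccontr)
  assume no: "\<not> ?thesis"
  let ?X = "bool_lists kx \<times> bool_lists ky" and ?A = "2 ^ kx * 2 ^ ky :: real"
  define S where "S t = (\<Sum>a\<in>?X. unity N (int t * T a))" for t
  define F where "F t = (1 + unity N (int t * int H)) * S t ^ 40 * unity N (- (int t * v))" for t
  define D where "D t = N div gcd (2 * t) N" for t
  define B where "B d = (if 2 \<le> d then ?A ^ 40 / (2 * real d ^ 3) else 0)" for d :: nat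
  have "(\<Sum>t<N. F t) = 0"
    unfolding F_def S_def using no by (intro representation_sum_eq_0 N finite_cartesian_product finite_bool_lists) blast
  moreover have "{..<N} = insert 0 {1..<N}" using N(1) by auto
  ultimately have "F 0 = - (\<Sum>t = 1..<N. F t)" by (simp add: add_eq_0_iff2)
  moreover have "F 0 = of_real (2 * ?A ^ 40)"
    by (simp add: F_def S_def card_cartesian_product finite_bool_lists)
  ultimately have "2 * ?A ^ 40 = norm (\<Sum>t = 1..<N. F t)"
    by (metis abs_of_nonneg norm_minus_cancel norm_of_real zero_le_mult_iff zero_le_numeral zero_le_power)
  also have "\<dots> \<le> (\<Sum>t = 1..<N. B (D t))"
  proof (intro sum_norm_le)
    fix t assume t: "t \<in> {1..<N}"
    show "norm (F t) \<le> B (D t)"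
    proof (cases "2 \<le> D t")
      case True
      have "norm (S t) ^ 40 \<le> ?A ^ 40 / (4 * real (D t) ^ 3)"
        unfolding S_def D_def using True T by (intro fib_val_sum_bound[OF N kx]) (auto simp: D_def)
      moreover have "norm (1 + unity N (int t * int H)) \<le> 2"
        using norm_triangle_ineq[of 1 "unity N (int t * int H)"] by simp
      ultimately have "norm (1 + unity N (int t * int H)) * norm (S t) ^ 40 \<le> 2 * (?A ^ 40 / (4 * real (D t) ^ 3))"
        by (intro mult_mono) auto
      then show ?thesis using True by (simp add: F_def B_def norm_mult norm_power)
    next
      case False
      then have "1 + unity N (int t * int H) = 0"
        using t by (intro half_modulus_character N H) (auto simp: D_def)
      then show ?thesis using False by (simp add: F_def B_def)
    qed
  qed
  \<comment> \<open>Group by level: at most \<open>2 * d\<close> characters, each bounded by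
    \<open>?A ^ 40 / (2 * d ^ 3)\<close>, give \<open>?A ^ 40 / d ^ 2\<close>.\<close>
  also have "\<dots> = (\<Sum>d\<le>N. \<Sum>t\<in>{t \<in> {1..<N}. D t = d}. B (D t))"
    by (intro sum.group[symmetric]) (auto simp: D_def)
  also have "\<dots> = (\<Sum>d\<le>N. real (card {t \<in> {1..<N}. D t = d}) * B d)"
    by (intro sum.cong refl) simp
  also have "\<dots> \<le> (\<Sum>d\<le>N. if 2 \<le> d then ?A ^ 40 * (1 / (real d)\<^sup>2) else 0)"
  proof (intro sum_mono)
    fix d assume "d \<in> {..N}"
    show "real (card {t \<in> {1..<N}. D t = d}) * B d \<le> (if 2 \<le> d then ?A ^ 40 * (1 / (real d)\<^sup>2) else 0)"
    proof (cases "2 \<le> d")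
      case True
      then have "real (card {t \<in> {1..<N}. D t = d}) \<le> real (2 * d)"
        using card_gcd_level[OF N(1), of d] unfolding D_def by (simp only: of_nat_le_iff)
      then have "real (card {t \<in> {1..<N}. D t = d}) * B d \<le> real (2 * d) * B d"
        by (intro mult_right_mono) (simp_all add: B_def)
      also have "\<dots> = ?A ^ 40 * (1 / (real d)\<^sup>2)"
        using True by (simp add: B_def power2_eq_square power3_eq_cube)
      finally show ?thesis using True by simp
    qed (simp add: B_def)
  qed
  also have "\<dots> = (\<Sum>d\<in>{d \<in> {..N}. 2 \<le> d}. ?A ^ 40 * (1 / (real d)\<^sup>2))"
    by (rule sum.inter_filter[symmetric]) simp
  also have "{d \<in> {..N}. 2 \<le> d} = {2..N}" by auto
  also have "(\<Sum>d = 2..N. ?A ^ 40 * (1 / (real d)\<^sup>2)) \<le> ?A ^ 40 * 1"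
    unfolding sum_distrib_left[symmetric] by (intro mult_left_mono sum_inverse_squares_le) simp
  finally show False by simp
qed

section \<open>The graphs\<close>

lemma fan_edges:
  assumes "2 \<le> n"
  shows "(x, y) \<in> set (fan ds n (Suc n) 0 1) \<Longrightarrow>
      fan_edge x y \<and> (x < 2 \<or> n \<le> x) \<and> n \<le> y \<and> y \<le> n + length ds"
    and "distinct (fan ds n (Suc n) 0 1)"
proof -
  have "(\<forall>x y. (x, y) \<in> set (fan ds n (Suc n) 0 1) \<longrightarrow>
      fan_edge x y \<and> (x < 2 \<or> n \<le> x) \<and> n \<le> y \<and> y \<le> n + length ds) \<and> distinct (fan ds n (Suc n) 0 1)"
    using assms
  proof (induction ds arbitrary: n)
    case (Cons d ds)
    have IH: "fan_edge x y" "x < 2 \<or> Suc n \<le> x" "Suc n \<le> y" "y \<le> Suc n + length ds"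
      if "(x, y) \<in> set (fan ds (Suc n) (Suc (Suc n)) 0 1)" for x y
      using Cons.IH[of "Suc n"] Cons.prems that by auto
    have "distinct (fan ds (Suc n) (Suc (Suc n)) 0 1)" using Cons.IH[of "Suc n"] Cons.prems by simp
    moreover have "(if d then 0 else 1, n) \<notin> set (fan ds (Suc n) (Suc (Suc n)) 0 1)"
      using IH(3) by fastforce
    moreover have "(n, Suc n) \<notin> set (fan ds (Suc n) (Suc (Suc n)) 0 1)"
      using IH(2)[of n "Suc n"] Cons.prems by auto
    moreover have "fan_edge (if d then 0 else 1) n" "fan_edge n (Suc n)"
      using Cons.prems by (auto simp: fan_edge_def)
    ultimately show ?case using IH Cons.prems by (fastforce split: if_splits)
  qed simp
  then show "(x, y) \<in> set (fan ds n (Suc n) 0 1) \<Longrightarrow>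
      fan_edge x y \<and> (x < 2 \<or> n \<le> x) \<and> n \<le> y \<and> y \<le> n + length ds"
    "distinct (fan ds n (Suc n) 0 1)" by auto
qed

lemma fans_edges:
  assumes "2 \<le> n"
  shows "(x, y) \<in> set (fans \<epsilon> dss n 0 1) \<Longrightarrow>
      fan_edge x y \<and> (x = 0 \<and> y = 1 \<or> n \<le> y \<and> y < n + fans_size dss)"
    and "distinct (fans \<epsilon> dss n 0 1)"
proof -
  have "(\<forall>x y. (x, y) \<in> set (fans \<epsilon> dss n 0 1) \<longrightarrow>
      fan_edge x y \<and> (x = 0 \<and> y = 1 \<or> n \<le> y \<and> y < n + fans_size dss)) \<and> distinct (fans \<epsilon> dss n 0 1)"
    using assms
  proof (induction dss arbitrary: n)
    case Nil
    then show ?case by (simp add: fan_edge_def)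
  next
    case (Cons ds dss)
    let ?n = "n + Suc (length ds)"
    have IH: "fan_edge x y" "x = 0 \<and> y = 1 \<or> ?n \<le> y \<and> y < ?n + fans_size dss"
      if "(x, y) \<in> set (fans \<epsilon> dss ?n 0 1)" for x y
      using Cons.IH[of ?n] Cons.prems that by auto
    note fan = fan_edges(1)[OF Cons.prems, of _ _ ds] fan_edges(2)[OF Cons.prems, of ds]
    have "distinct (fans \<epsilon> dss ?n 0 1)" using Cons.IH[of ?n] Cons.prems by simp
    \<comment> \<open>Larger ends of edges of the first fan are at least \<open>n\<close> and below
      \<open>?n\<close>; later edges end at \<open>?n\<close> or beyond, except the hub edge, which
      ends at 1.\<close>
    moreover have "set (fan ds n (Suc n) 0 1) \<inter> set (fans \<epsilon> dss ?n 0 1) = {}"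
      using fan(1) IH(2) Cons.prems by fastforce
    ultimately have "distinct (fans \<epsilon> (ds # dss) n 0 1)" using fan(2) by simp
    moreover have "fan_edge x y \<and> (x = 0 \<and> y = 1 \<or> n \<le> y \<and> y < n + fans_size (ds # dss))"
      if "(x, y) \<in> set (fans \<epsilon> (ds # dss) n 0 1)" for x y
      using that fan(1)[of x y] IH[of x y] by auto
    ultimately show ?case by blast
  qed
  then show "(x, y) \<in> set (fans \<epsilon> dss n 0 1) \<Longrightarrow>
      fan_edge x y \<and> (x = 0 \<and> y = 1 \<or> n \<le> y \<and> y < n + fans_size dss)"
    "distinct (fans \<epsilon> dss n 0 1)" by auto
qed

lemma fans_graph:
  fixes \<epsilon> dss
  defines "V \<equiv> {..<fans_size dss + 2}" and "E \<equiv> ends ` set (fans \<epsilon> dss 2 0 1)"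
  shows "simple_graph V E" "planar_graph V E" "num_spanning_trees V E = fansT \<epsilon> dss"
proof -
  have props: "fan_edge x y" "x < y" "{x, y} \<subseteq> V" if "(x, y) \<in> set (fans \<epsilon> dss 2 0 1)" for x y
    using fans_edges(1)[OF order_refl that] by (auto simp: fan_edge_def V_def)
  have ends: "\<forall>e\<in>set (fans \<epsilon> dss 2 0 1). fst e \<noteq> snd e \<and> ends e \<subseteq> V"
    using props(2,3) by fastforce
  have "e \<subseteq> V \<and> card e = 2" if "e \<in> E" for e
    using that ends by (auto simp: E_def card_insert_if)
  then show "simple_graph V E" by (auto simp: simple_graph_def V_def)
  show "planar_graph V E"
    by (rule planar_fan_edges) (use props(1) in \<open>fastforce simp: E_def\<close>)
  \<comment> \<open>All listed pairs are ascending, so distinct pairs give distinct sets.\<close>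
  have "inj_on ends (set (fans \<epsilon> dss 2 0 1))"
  proof (rule inj_onI)
    fix e f assume "e \<in> set (fans \<epsilon> dss 2 0 1)" "f \<in> set (fans \<epsilon> dss 2 0 1)" "ends e = ends f"
    then show "e = f"
      using props(2)[of "fst e" "snd e"] props(2)[of "fst f" "snd f"]
      by (auto simp: doubleton_eq_iff prod_eq_iff)
  qed
  then have "distinct (map ends (fans \<epsilon> dss 2 0 1))" using fans_edges(2) by (simp add: distinct_map)
  then have "num_spanning_trees V E = tree_count (fans \<epsilon> dss 2 0 1) (card V)"
    unfolding E_def using ends by (intro num_spanning_trees_eq_tree_count) (auto simp: V_def)
  then show "num_spanning_trees V E = fansT \<epsilon> dss"
    using tree_count_fans[of 0 2 1 \<epsilon> dss] by (simp add: V_def)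
qed

text \<open>The additional factor \<open>fib (2 * q)\<close> avoids the exponent
  \<open>length dss - 1\<close> and is cancelled later by coprimality.\<close>

lemma fansT_eq:
  assumes "\<forall>ds\<in>set dss. length ds = q"
  shows "fib (2 * q) * fansT \<epsilon> dss =
    fib (2 * q) ^ length dss * (sum_list (map fanT0 dss) + of_bool \<epsilon> * fib (2 * q))"
proof -
  have "fansH dss = fib (2 * q) ^ length dss \<and> fib (2 * q) * fansT \<epsilon> dss =
    fib (2 * q) ^ length dss * (sum_list (map fanT0 dss) + of_bool \<epsilon> * fib (2 * q))"
    using assms by (induction dss) (auto simp: fanH_fib(1) algebra_simps)
  then show ?thesis ..
qed

lemma graph_for_residue:
  assumes N: "N > 0" "N \<le> 2 ^ k" and q: "2 * k \<le> q" "coprime (fib (2 * q)) N"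
  shows "\<exists>(V :: nat set) E. simple_graph V E \<and> planar_graph V E \<and> card V = 40 * q + 42 \<and>
         [num_spanning_trees V E = u] (mod N)"
proof -
  let ?H = "fib (2 * q)"
  obtain g h where gh: "\<And>xs ys. length xs = k \<Longrightarrow> length ys = q - k \<Longrightarrow>
     int (fanT0 (rev xs @ ys)) = g xs + h ys - 2 * int (fib_val xs) * int (fib_val ys)"
    using fanT0_bilinear[of k "q - k"] by metis
  obtain i where i: "[?H * i = 1] (mod N)" using cong_solve_coprime_nat[OF q(2)] by auto
  \<comment> \<open>With \<open>i\<close> inverse to \<open>?H\<close>, the sum must hit this target
    for the factor \<open>?H ^ 39\<close> to turn it into \<open>u\<close>.\<close>
  define v where "v = i ^ 39 * u"
  let ?f = "\<lambda>(xs, ys). rev xs @ ys :: bool list"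
  have "\<exists>as \<epsilon>. length as = 40 \<and> set as \<subseteq> bool_lists k \<times> bool_lists (q - k) \<and>
      int N dvd sum_list (map (\<lambda>a. int (fanT0 (?f a))) as) + of_bool \<epsilon> * int ?H - int v"
    by (rule residue_represented[OF N]) (use q gh in \<open>auto\<close>)
  then obtain as \<epsilon> where as: "length as = 40" "set as \<subseteq> bool_lists k \<times> bool_lists (q - k)"
    and dvd: "int N dvd sum_list (map (\<lambda>a. int (fanT0 (?f a))) as) + of_bool \<epsilon> * int ?H - int v"
    by blast
  define dss where "dss = map ?f as"
  have len: "\<forall>ds\<in>set dss. length ds = q" "length dss = 40" using as q(1) by (auto simp: dss_def)
  let ?S = "sum_list (map fanT0 dss) + of_bool \<epsilon> * ?H"
  have "sum_list (map (\<lambda>a. int (fanT0 (?f a))) as) + of_bool \<epsilon> * int ?H = int ?S"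
    by (simp add: dss_def comp_def flip: sum_list_of_nat)
  then have "[int ?S = int v] (mod int N)" using dvd by (simp only: cong_iff_dvd_diff)
  then have S: "[?S = v] (mod N)" by (simp only: cong_int_iff)
  have "[?H ^ 40 * ?S = ?H ^ 40 * v] (mod N)" using S by (rule cong_scalar_left)
  also have "?H ^ 40 * v = ?H * ((?H * i) ^ 39 * u)"
    by (simp add: v_def power_mult_distrib mult_ac flip: power_Suc)
  also have "[\<dots> = ?H * (1 ^ 39 * u)] (mod N)"
    by (intro cong_scalar_left cong_scalar_right cong_pow i)
  finally have "[?H * fansT \<epsilon> dss = ?H * u] (mod N)" using fansT_eq[OF len(1), of \<epsilon>] len(2) by simp
  then have "[fansT \<epsilon> dss = u] (mod N)" using cong_mult_lcancel_nat q(2) by blast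
  \<comment> \<open>Each of the forty fans has \<open>q\<close> path vertices with a spoke and one
    leaf; the hubs add two more vertices.\<close>
  moreover have "fans_size dss = 40 * (q + 1)"
  proof -
    have "map (\<lambda>ds. Suc (length ds)) dss = replicate 40 (q + 1)"
      using len by (intro replicate_eqI) auto
    then show ?thesis by (simp add: sum_list_replicate)
  qed
  ultimately show ?thesis
    using fans_graph[of dss \<epsilon>]
    by (intro exI[of _ "{..<fans_size dss + 2}"] exI[of _ "ends ` set (fans \<epsilon> dss 2 0 1)"]) simp
qed

lemma ex_coprime_fib_linear:
  "\<exists>c. \<forall>N k. 2 \<le> N \<longrightarrow> N \<le> 2 ^ k \<longrightarrow> (\<exists>q. 2 * k \<le> q \<and> q \<le> c * k \<and> coprime (fib (2 * q)) N)"
proof -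
  obtain k0 where k0: "\<And>k N. k0 \<le> k \<Longrightarrow> 1 \<le> N \<Longrightarrow> N \<le> 2 ^ k \<Longrightarrow>
     \<exists>q. prime q \<and> 2 * k < q \<and> q \<le> 8 * k \<and> coprime (fib (2 * q)) N"
    using eventually_coprime_fib by blast
  \<comment> \<open>For \<open>k < k0\<close> only finitely many moduli remain; taking
    \<open>q\<close> above \<open>2 * k0\<close> ensures \<open>2 * k \<le> q\<close>, and the
    maximum of the choices goes into \<open>c\<close>.\<close>
  have "\<forall>N. \<exists>q. 1 \<le> N \<longrightarrow> 2 * k0 < q \<and> coprime (fib (2 * q)) N"
    using ex_coprime_fib by blast
  then obtain f where f: "\<And>N. 1 \<le> N \<Longrightarrow> 2 * k0 < f N \<and> coprime (fib (2 * f N)) N" by metis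
  define c where "c = Max (f ` {..2 ^ k0}) + 8"
  have "\<exists>q. 2 * k \<le> q \<and> q \<le> c * k \<and> coprime (fib (2 * q)) N" if N: "2 \<le> N" "N \<le> 2 ^ k" for N k
  proof (cases "k0 \<le> k")
    case True
    then obtain q where "2 * k < q" "q \<le> 8 * k" "coprime (fib (2 * q)) N" using k0[of k N] N by auto
    moreover have "8 * k \<le> c * k" by (simp add: c_def)
    ultimately show ?thesis by (intro exI[of _ q]) linarith
  next
    case False
    then have "N \<le> 2 ^ k0" using N(2) by (meson le_trans nat_le_linear one_le_numeral power_increasing)
    then have "f N \<le> c" unfolding c_def by (intro trans_le_add1 Max_ge) auto
    moreover have "k \<noteq> 0" using N by (intro notI) simp
    ultimately have "f N \<le> c * k" by (metis le_trans mult.right_neutral mult_le_mono2 Suc_leI gr0I One_nat_def)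
    then show ?thesis using f[of N] N(1) False by (intro exI[of _ "f N"]) auto
  qed
  then show ?thesis by blast
qed

theorem theorem1p3:
  shows "\<exists>C::real. C > 0 \<and>
    (\<forall>N::nat. N \<ge> 2 \<longrightarrow> (\<forall>u::nat. u < N \<longrightarrow>
      (\<exists>(V :: nat set) E. simple_graph V E \<and> planar_graph V E \<and>
         real (card V) \<le> C * log 2 (real N) \<and>
         [num_spanning_trees V E = u] (mod N))))"
proof -
  obtain c where c: "\<And>N k. 2 \<le> N \<Longrightarrow> N \<le> 2 ^ k \<Longrightarrow>
      \<exists>q. 2 * k \<le> q \<and> q \<le> c * k \<and> coprime (fib (2 * q)) N"
    using ex_coprime_fib_linear by blast
  \<comment> \<open>Since \<open>k \<ge> 1\<close>, \<open>40 * q + 42\<close> is at most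
    \<open>(40 * c + 42) * k\<close>. The factor 2 absorbs the rounding up of the logarithm, which
    is at least 1.\<close>
  let ?C = "2 * (40 * real c + 42)"
  have "\<exists>(V :: nat set) E. simple_graph V E \<and> planar_graph V E \<and>
      real (card V) \<le> ?C * log 2 (real N) \<and> [num_spanning_trees V E = u] (mod N)" if N: "2 \<le> N" for N u :: nat
  proof -
    define k where "k = nat \<lceil>log 2 (real N)\<rceil>"
    have log1: "1 \<le> log 2 (real N)" using N by simp
    then have k: "log 2 (real N) \<le> real k" "real k \<le> 2 * log 2 (real N)" "1 \<le> k"
      unfolding k_def by linarith+
    have "real N = 2 powr log 2 (real N)" using N by simp
    also have "\<dots> \<le> 2 powr real k" using k(1) by (intro powr_mono) auto
    also have "\<dots> = real (2 ^ k)" by (simp add: powr_realpow)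
    finally have Nk: "N \<le> 2 ^ k" by (simp only: of_nat_le_iff)
    obtain q where q: "2 * k \<le> q" "q \<le> c * k" "coprime (fib (2 * q)) N" using c[OF N Nk] by blast
    obtain V :: "nat set" and E where G: "simple_graph V E" "planar_graph V E" "card V = 40 * q + 42"
      "[num_spanning_trees V E = u] (mod N)"
      using graph_for_residue[OF _ Nk q(1,3), of u] N by auto
    have "card V \<le> (40 * c + 42) * k" using G(3) q(2) k(3) by (simp add: algebra_simps)
    then have "real (card V) \<le> (40 * real c + 42) * real k"
      by (metis (mono_tags, lifting) of_nat_add of_nat_le_iff of_nat_mult of_nat_numeral)
    also have "\<dots> \<le> (40 * real c + 42) * (2 * log 2 (real N))" using k(2) by (intro mult_left_mono) auto
    also have "\<dots> = ?C * log 2 (real N)" by simp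
    finally show ?thesis using G by blast
  qed
  then show ?thesis by (intro exI[of _ ?C]) auto
qed

end
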